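(* For every $(b,\tau_0)\in\mathfrak P$, the map $\Psi_{b,\tau_0}:\mathcal X\to\mathcal X$ is $G$-equivariant, i.e. $\Psi_{b,\tau_0}(gx)=g\Psi_{b,\tau_0}(x)$ for all $g\in G$, $x\in\mathcal X$. Moreover, $\Psi_{b,\tau_0}$ is a compact perturbation of the identity and depends continuously on $(b,\tau_0)\in\mathfrak P$, uniformly on bounded subsets of $\mathcal X$.
   Context: Fix a positive integer $n$ and constants $a>0$, $\delta>0$, $c\ge 0$, $\beta>0$, $\tau_c\ge 0$; put $\eta=a+\delta$, $\alpha=a\delta$. Parameter domain: $\mathfrak P=(0,\infty)\times[0,\infty)\ni(b,\tau_0)$. Indices $k$ are taken modulo $n$. Spaces: $\mathcal X=H^2_{\mathrm{per}}([0,2\pi],\mathbb R^n)$ with $\langle x,z\rangle_{\mathcal X}=\int_0^{2\pi}(x''\cdot z''+x'\cdot z'+x\cdot z)\,dt$, and $\mathcal Y=L^2([0,2\pi],\mathbb R^n)$; functions are extended $2\pi$-periodically. Group: $G=D_n\times\mathbb Z_2\times S^1$ acts on $\mathcal X$ and $\mathcal Y$ by $(gx)(t)=\gamma\,\iota\,x(t+\theta)$ for $g=(\gamma,\iota,\theta)$, where the dihedral group $D_n$ (rotations and reflections of the ring of indices modulo $n$) acts on $\mathbb R^n$ by permuting coordinates, $\mathbb Z_2=\{\pm1\}$ acts by multiplication, and $\theta\in S^1=\mathbb R/2\pi\mathbb Z$. Operators: for $x=(x_1,\dots,x_n)$, $\mathscr F_{b,\tau_0}(x)$ has components $$\mathscr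 F_{b,\tau_0,k}(x)(t)=-\eta x_k'(t)-\alpha x_k(t)-b x_k(t-\tau_0)+c\bigl(x_{k+1}(t-\tau_c)-2x_k(t)+x_{k-1}(t-\tau_c)\bigr)-\beta x_k^3(t).$$ $\mathcal A:\mathcal X\to\mathcal Y$, $\mathcal A x=x''-x$, is an isomorphism, and $$\Psi_{b,\tau_0}(x)=x-\mathcal A^{-1}\bigl(\mathscr F_{b,\tau_0}(x)-x\bigr),\qquad x\in\mathcal X.$$ "Compact perturbation of the identity" means that $\Psi_{b,\tau_0}-\mathrm{Id}$ is continuous and maps bounded sets to relatively compact sets. "Depends continuously, uniformly on bounded subsets" means: for each $p\in\mathfrak P$ and each bounded $B\subset\mathcal X$, $\sup_{x\in B}\|\Psi_{p'}(x)-\Psi_p(x)\|_{\mathcal X}\to0$ as $p'\to p$ in $\mathfrak P$. *)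

theory Defs
  imports "HOL-Analysis.Analysis" "Berlekamp_Zassenhaus.Finite_Field"
begin

section \<open>The space $\mathcal Y$: square-integrable $2\pi$-periodic functions\<close>

text \<open>
  Elements of $L^2([0,2\pi])$ are handled through Borel representatives extended periodically;
  two representatives are identified when they agree almost everywhere.
\<close>

definition L2_per :: "(real \<Rightarrow> 'a::euclidean_space) set" where
  "L2_per = {y. periodic_fun_simple y (2 * pi) \<and> y \<in> borel_measurable borel \<and>
     set_integrable lborel {0..2 * pi} (\<lambda>t. (norm (y t))\<^sup>2)}"

lemma periodic2pi_iff: "periodic_fun_simple y (2 * pi) \<longleftrightarrow> (\<forall>t. y (t + 2 * pi) = y t)"
  by (simp add: periodic_fun_simple_def)

lemma L2_per_measurable: "y \<in> L2_per \<Longrightarrow> y \<in> borel_measurable lborel"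
  by (simp add: L2_per_def)

lemma L2_per_inner:
  assumes "y \<in> L2_per" "z \<in> L2_per"
  shows "set_integrable lborel {0..2 * pi} (\<lambda>t. y t \<bullet> z t)"
proof (rule set_integrable_bound)
  show "set_integrable lborel {0..2 * pi} (\<lambda>t. (norm (y t))\<^sup>2 + (norm (z t))\<^sup>2)"
    using assms by (intro set_integral_add) (auto simp: L2_per_def)
  show "set_borel_measurable lborel {0..2 * pi} (\<lambda>t. y t \<bullet> z t)"
    using assms[THEN L2_per_measurable] unfolding set_borel_measurable_def by measurable
  have "norm (y t \<bullet> z t) \<le> norm ((norm (y t))\<^sup>2 + (norm (z t))\<^sup>2)" for t
  proof -
    have "\<bar>y t \<bullet> z t\<bar> \<le> norm (y t) * norm (z t)" by (rule Cauchy_Schwarz_ineq2)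
    also have "\<dots> \<le> (norm (y t))\<^sup>2 + (norm (z t))\<^sup>2"
      using sum_squares_bound[of "norm (y t)" "norm (z t)"]
        mult_nonneg_nonneg[OF norm_ge_zero norm_ge_zero, of "y t" "z t"] by linarith
    finally show ?thesis by simp
  qed
  then show "AE t in lborel. t \<in> {0..2 * pi} \<longrightarrow>
      norm (y t \<bullet> z t) \<le> norm ((norm (y t))\<^sup>2 + (norm (z t))\<^sup>2)" by simp
qed

lemma L2_per_zero: "(\<lambda>t. 0) \<in> L2_per"
  by (simp add: L2_per_def periodic2pi_iff set_integrable_def)

lemma L2_per_linear:
  fixes L :: "'a::euclidean_space \<Rightarrow> 'b::euclidean_space"
  assumes L: "bounded_linear L" and y: "y \<in> L2_per"
  shows "(\<lambda>t. L (y t)) \<in> L2_per"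
proof -
  obtain K where K: "\<And>v. norm (L v) \<le> norm v * K" "K > 0"
    using bounded_linear.pos_bounded[OF L] by blast
  have m: "(\<lambda>t. L (y t)) \<in> borel_measurable borel"
    using y borel_measurable_continuous_onI[OF linear_continuous_on[OF L, of UNIV]]
    by (auto simp: L2_per_def)
  have "set_integrable lborel {0..2 * pi} (\<lambda>t. (norm (L (y t)))\<^sup>2)"
  proof (rule set_integrable_bound)
    show "set_integrable lborel {0..2 * pi} (\<lambda>t. K\<^sup>2 * (norm (y t))\<^sup>2)"
      using y by (intro set_integrable_mult_right) (auto simp: L2_per_def)
    show "set_borel_measurable lborel {0..2 * pi} (\<lambda>t. (norm (L (y t)))\<^sup>2)"
      using m unfolding set_borel_measurable_def by measurable
    have "(norm (L (y t)))\<^sup>2 \<le> (norm (y t) * K)\<^sup>2" for t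
      by (rule power_mono[OF K(1)]) simp
    then show "AE t in lborel. t \<in> {0..2 * pi} \<longrightarrow>
        norm ((norm (L (y t)))\<^sup>2) \<le> norm (K\<^sup>2 * (norm (y t))\<^sup>2)"
      by (simp add: power_mult_distrib mult.commute)
  qed
  then show ?thesis using y m by (auto simp: L2_per_def periodic2pi_iff)
qed

lemma L2_per_add:
  assumes "y \<in> L2_per" "z \<in> L2_per"
  shows "(\<lambda>t. y t + z t) \<in> L2_per"
proof -
  have "set_integrable lborel {0..2 * pi} (\<lambda>t. y t \<bullet> y t + 2 * (y t \<bullet> z t) + z t \<bullet> z t)"
    using assms by (intro set_integral_add set_integrable_mult_right L2_per_inner)
  then have "set_integrable lborel {0..2 * pi} (\<lambda>t. (norm (y t + z t))\<^sup>2)"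
    by (simp add: power2_norm_eq_inner inner_add inner_commute algebra_simps)
  then show ?thesis using assms by (auto simp: L2_per_def periodic2pi_iff)
qed

lemma set_integrable_shift:
  fixes f :: "real \<Rightarrow> 'a::euclidean_space"
  shows "set_integrable lborel {a..b} (\<lambda>t. f (t + \<theta>)) \<longleftrightarrow> set_integrable lborel {a + \<theta>..b + \<theta>} f"
proof -
  have "(\<lambda>t. indicat_real {a..b} t *\<^sub>R f (t + \<theta>)) =
      (\<lambda>t. indicat_real {a + \<theta>..b + \<theta>} (\<theta> + 1 * t) *\<^sub>R f (\<theta> + 1 * t))"
    by (auto simp: indicator_def add.commute)
  then show ?thesis
    using lborel_integrable_real_affine_iff
      [of 1 "\<lambda>t. indicat_real {a + \<theta>..b + \<theta>} t *\<^sub>R f t" \<theta>]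
    unfolding set_integrable_def by simp
qed

lemma set_integral_shift:
  fixes f :: "real \<Rightarrow> 'a::euclidean_space"
  shows "(LINT t:{a..b}|lborel. f (t + \<theta>)) = (LINT t:{a + \<theta>..b + \<theta>}|lborel. f t)"
proof -
  have "(\<lambda>t. indicat_real {a..b} t *\<^sub>R f (t + \<theta>)) =
      (\<lambda>t. indicat_real {a + \<theta>..b + \<theta>} (\<theta> + 1 * t) *\<^sub>R f (\<theta> + 1 * t))"
    by (auto simp: indicator_def add.commute)
  then show ?thesis
    unfolding set_lebesgue_integral_def
    using lborel_integral_real_affine[of 1 "\<lambda>t. indicat_real {a + \<theta>..b + \<theta>} t *\<^sub>R f t" \<theta>]
    by simp
qed

lemma periodic_set_integrable:
  fixes g :: "real \<Rightarrow> 'a::euclidean_space"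
  assumes per: "\<And>t. g (t + 2 * pi) = g t" and i: "set_integrable lborel {0..2 * pi} g"
  shows "set_integrable lborel {a..b} g"
proof -
  interpret periodic_fun_simple g "2 * pi" by standard (rule per)
  have gs: "g (t + of_int k * (2 * pi)) = g t" for t and k :: int by (rule plus_of_int)
  have 1: "set_integrable lborel {of_int k * (2 * pi)..of_int (k + 1) * (2 * pi)} g" for k :: int
  proof -
    have "set_integrable lborel {0..2 * pi} (\<lambda>t. g (t + of_int k * (2 * pi)))"
      unfolding gs by (rule i)
    then show ?thesis by (simp add: set_integrable_shift algebra_simps)
  qed
  have 2: "set_integrable lborel {- real n * (2 * pi)..real n * (2 * pi)} g" for n :: nat
  proof (induction n)
    case 0
    then show ?case
      by (rule set_integrable_subset[OF 1[of 0]]) auto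
  next
    case (Suc n)
    have "{- real (Suc n) * (2 * pi)..real (Suc n) * (2 * pi)} \<subseteq>
       {of_int (- int (Suc n)) * (2 * pi)..of_int (- int (Suc n) + 1) * (2 * pi)}
       \<union> {- real n * (2 * pi)..real n * (2 * pi)}
       \<union> {of_int (int n) * (2 * pi)..of_int (int n + 1) * (2 * pi)}"
      by (auto simp: algebra_simps)
    then show ?case
      by (rule set_integrable_subset[rotated 2]) (intro set_integrable_Un 1 Suc, auto)
  qed
  obtain n :: nat where n: "real n > max \<bar>a\<bar> \<bar>b\<bar>" using reals_Archimedean2 by blast
  have "real n \<le> real n * (2 * pi)" using pi_gt3 by (simp add: mult_le_cancel_left1)
  then have "{a..b} \<subseteq> {- real n * (2 * pi)..real n * (2 * pi)}" using n by auto
  then show ?thesis by (rule set_integrable_subset[OF 2, rotated]) simp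
qed

lemma L2_per_shift:
  assumes "y \<in> L2_per" shows "(\<lambda>t. y (t + \<theta>)) \<in> L2_per"
proof -
  have per: "y (t + 2 * pi) = y t" for t using assms by (simp add: L2_per_def periodic2pi_iff)
  have "y (t + 2 * pi + \<theta>) = y (t + \<theta>)" for t
    using per[of "t + \<theta>"] by (simp add: algebra_simps)
  moreover have "set_integrable lborel {0 + \<theta>..2 * pi + \<theta>} (\<lambda>t. (norm (y t))\<^sup>2)"
    by (rule periodic_set_integrable) (use assms in \<open>auto simp: L2_per_def per\<close>)
  ultimately show ?thesis
    using assms set_integrable_shift[of 0 "2 * pi" "\<lambda>t. (norm (y t))\<^sup>2" \<theta>]
    by (auto simp: L2_per_def periodic2pi_iff)
qed


section \<open>The space $\mathcal X$: the periodic Sobolev space $H^2_{\mathrm{per}}$\<close>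

text \<open>\<open>f\<close> is (locally) absolutely continuous with weak derivative \<open>g\<close>.\<close>

definition has_ac_derivative :: "(real \<Rightarrow> 'a::euclidean_space) \<Rightarrow> (real \<Rightarrow> 'a) \<Rightarrow> bool"
    (infix "has'_ac'_derivative" 50) where
  "f has_ac_derivative g \<longleftrightarrow>
     (\<forall>s t. s \<le> t \<longrightarrow> set_integrable lborel {s..t} g \<and> f t - f s = (LINT u:{s..t}|lborel. g u))"

text \<open>
  An element of $H^2_{\mathrm{per}}$ is represented by its unique continuous version, which is
  $C^1$; its derivative is absolutely continuous with a weak derivative in $L^2$.
\<close>

definition H2_per :: "(real \<Rightarrow> 'a::euclidean_space) set" where
  "H2_per = {x. periodic_fun_simple x (2 * pi) \<and> (\<forall>t. x differentiable (at t)) \<and>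
     (\<exists>w\<in>L2_per. (\<lambda>t. vector_derivative x (at t)) has_ac_derivative w)}"

lemma has_ac_derivative_add:
  "f has_ac_derivative g \<Longrightarrow> f' has_ac_derivative g' \<Longrightarrow>
   (\<lambda>t. f t + f' t) has_ac_derivative (\<lambda>t. g t + g' t)"
  by (auto simp: has_ac_derivative_def set_integral_add algebra_simps)

lemma has_ac_derivative_linear:
  fixes L :: "'a::euclidean_space \<Rightarrow> 'b::euclidean_space"
  assumes L: "bounded_linear L" and f: "f has_ac_derivative g"
  shows "(\<lambda>t. L (f t)) has_ac_derivative (\<lambda>t. L (g t))"
  unfolding has_ac_derivative_def
proof (intro allI impI)
  fix s t :: real assume "s \<le> t"
  then have i: "set_integrable lborel {s..t} g" and e: "f t - f s = (LINT u:{s..t}|lborel. g u)"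
    using f by (auto simp: has_ac_derivative_def)
  interpret bounded_linear L by (rule L)
  have eq: "(\<lambda>u. indicat_real {s..t} u *\<^sub>R L (g u)) = (\<lambda>u. L (indicat_real {s..t} u *\<^sub>R g u))"
    by (simp add: scaleR)
  have "set_integrable lborel {s..t} (\<lambda>t. L (g t))"
    using integrable_bounded_linear[OF L i[unfolded set_integrable_def]]
    by (simp add: set_integrable_def eq)
  moreover have "L (f t) - L (f s) = (LINT u:{s..t}|lborel. L (g u))"
    using integral_bounded_linear[OF L i[unfolded set_integrable_def]] e
    by (simp add: set_lebesgue_integral_def eq diff[symmetric])
  ultimately show "set_integrable lborel {s..t} (\<lambda>t. L (g t)) \<and>
      L (f t) - L (f s) = (LINT u:{s..t}|lborel. L (g u))" ..
qed

lemma has_ac_derivative_shift: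
  assumes "f has_ac_derivative g"
  shows "(\<lambda>t. f (t + \<theta>)) has_ac_derivative (\<lambda>t. g (t + \<theta>))"
  using assms by (auto simp: has_ac_derivative_def set_integrable_shift set_integral_shift)

lemma has_ac_derivative_continuous:
  assumes "f has_ac_derivative g" shows "continuous_on UNIV f"
proof -
  have c: "continuous_on {a..b} f" if "a \<le> b" for a b
  proof -
    have i: "set_integrable lborel {a..b} g" using assms that by (auto simp: has_ac_derivative_def)
    have gi: "g integrable_on {a..b}" by (rule set_borel_integral_eq_integral(1)[OF i])
    have "f t = f a + integral {a..t} g" if "t \<in> {a..b}" for t
    proof -
      have "set_integrable lborel {a..t} g" "f t - f a = (LINT u:{a..t}|lborel. g u)"
        using assms that by (auto simp: has_ac_derivative_def)
      then show ?thesis using set_borel_integral_eq_integral(2) by (metis add.commute diff_add_cancel)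
    qed
    moreover have "continuous_on {a..b} (\<lambda>t. f a + integral {a..t} g)"
      by (intro continuous_intros indefinite_integral_continuous_1 gi)
    ultimately show ?thesis
      using continuous_on_cong[of "{a..b}" "{a..b}" f "\<lambda>t. f a + integral {a..t} g"] by blast
  qed
  have "isCont f t" for t
    using c[of "t - 1" "t + 1"] by (auto intro: continuous_on_interior)
  then show ?thesis by (simp add: continuous_at_imp_continuous_on)
qed

lemma has_ac_derivative_unique:
  assumes "f has_ac_derivative g" "f has_ac_derivative h"
  shows "AE t\<in>{a..b} in lborel. g t = h t"
proof -
  define d where "d = (\<lambda>t. indicat_real {a..b} t *\<^sub>R (g t - h t))"
  have id: "set_integrable lborel {s..t} (\<lambda>u. g u - h u)"
    and zd: "(LINT u:{s..t}|lborel. g u - h u) = 0" if "s \<le> t" for s t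
  proof -
    have "set_integrable lborel {s..t} g" "f t - f s = (LINT u:{s..t}|lborel. g u)"
      "set_integrable lborel {s..t} h" "f t - f s = (LINT u:{s..t}|lborel. h u)"
      using assms that by (auto simp: has_ac_derivative_def)
    then show "set_integrable lborel {s..t} (\<lambda>u. g u - h u)"
      "(LINT u:{s..t}|lborel. g u - h u) = 0" by (auto simp: set_integral_diff)
  qed
  have di: "integrable lborel d"
  proof (cases "a \<le> b")
    case True
    then show ?thesis using id[of a b] by (simp add: d_def set_integrable_def)
  next
    case False
    then have "d = (\<lambda>t. 0)" by (auto simp: d_def)
    then show ?thesis by simp
  qed
  have dS: "set_integrable lborel A d" if "A \<in> sets borel" for A
    using integrable_mult_indicator[OF _ di, of A] that by (simp add: set_integrable_def)
  have di0: "(LINT u:{s..t}|lborel. d u) = 0" for s t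
  proof -
    have "indicat_real {s..t} u *\<^sub>R d u = indicat_real {max s a..min t b} u *\<^sub>R (g u - h u)" for u
      by (auto simp: d_def indicator_def)
    then have "(LINT u:{s..t}|lborel. d u) = (LINT u:{max s a..min t b}|lborel. g u - h u)"
      unfolding set_lebesgue_integral_def by simp
    also have "\<dots> = 0"
    proof (cases "max s a \<le> min t b")
      case False
      then have "{max s a..min t b} = {}" by simp
      then show ?thesis by (simp only: set_lebesgue_integral_def) simp
    qed (rule zd)
    finally show ?thesis .
  qed
  have U0: "(LINT u|lborel. d u) = 0"
  proof -
    have "indicat_real {a..b} u *\<^sub>R d u = d u" for u
      by (auto simp: d_def indicator_def)
    then have "(LINT u|lborel. d u) = (LINT u:{a..b}|lborel. d u)"
      unfolding set_lebesgue_integral_def by simp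
    then show ?thesis using di0 by simp
  qed
  have "(LINT u:A|lborel. d u) = 0" if "A \<in> sets borel" for A
    using that
  proof (induction A rule: borel_set_induct)
    case empty
    then show ?case by (simp add: set_lebesgue_integral_def)
  next
    case (interval a b)
    show ?case by (rule di0)
  next
    case (compl A)
    have "(LINT u:UNIV|lborel. d u) = (LINT u:A|lborel. d u) + (LINT u:- A|lborel. d u)"
      using compl by (subst set_integral_Un[symmetric]) (auto intro!: dS)
    then show ?case using compl U0 by (simp add: set_lebesgue_integral_def Compl_eq_Diff_UNIV)
  next
    case (union A)
    have "(LINT u:(\<Union>i. A i)|lborel. d u) = (\<Sum>i. LINT u:A i|lborel. d u)"
      using union by (intro lebesgue_integral_countable_add dS) (auto simp: disjoint_family_on_def)
    then show ?case using union by simp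
  qed
  then have "AE t in lborel. d t = 0" by (intro sigma_finite_measure.density_zero[OF sigma_finite_lborel] di) simp
  then show ?thesis by eventually_elim (auto simp: d_def indicator_def split: if_splits)
qed

lemma H2_perI:
  assumes "\<And>t. x (t + 2 * pi) = x t" "\<And>t. (x has_vector_derivative v t) (at t)"
    "w \<in> L2_per" "v has_ac_derivative w"
  shows "x \<in> H2_per"
proof -
  have "vector_derivative x (at t) = v t" for t
    using assms(2) by (rule vector_derivative_at)
  moreover have "x differentiable (at t)" for t
    using assms(2) by (rule differentiableI_vector)
  ultimately show ?thesis using assms by (auto simp: H2_per_def periodic2pi_iff)
qed

lemma H2_perE:
  assumes "x \<in> H2_per"
  obtains w where "\<And>t. x (t + 2 * pi) = x t"
    "\<And>t. (x has_vector_derivative vector_derivative x (at t)) (at t)"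
    "w \<in> L2_per" "(\<lambda>t. vector_derivative x (at t)) has_ac_derivative w"
proof -
  from assms obtain w where "w \<in> L2_per" "(\<lambda>t. vector_derivative x (at t)) has_ac_derivative w"
    by (auto simp: H2_per_def)
  moreover have "x (t + 2 * pi) = x t" for t
    using assms by (simp add: H2_per_def periodic2pi_iff)
  moreover have "(x has_vector_derivative vector_derivative x (at t)) (at t)" for t
    using assms by (simp add: H2_per_def vector_derivative_works[symmetric])
  ultimately show thesis using that by blast
qed

lemma H2_per_zero: "(\<lambda>t. 0) \<in> H2_per"
  by (rule H2_perI[where v = "\<lambda>t. 0" and w = "\<lambda>t. 0"])
     (auto simp: L2_per_zero has_ac_derivative_def set_integrable_def set_lebesgue_integral_def)

lemma H2_per_add:
  assumes "x \<in> H2_per" "z \<in> H2_per" shows "(\<lambda>t. x t + z t) \<in> H2_per"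
proof (rule H2_perE[OF assms(1)], rule H2_perE[OF assms(2)])
  fix v w
  assume x: "\<And>t. x (t + 2 * pi) = x t"
      "\<And>t. (x has_vector_derivative vector_derivative x (at t)) (at t)"
      "v \<in> L2_per" "(\<lambda>t. vector_derivative x (at t)) has_ac_derivative v"
    and z: "\<And>t. z (t + 2 * pi) = z t"
      "\<And>t. (z has_vector_derivative vector_derivative z (at t)) (at t)"
      "w \<in> L2_per" "(\<lambda>t. vector_derivative z (at t)) has_ac_derivative w"
  show ?thesis
    by (rule H2_perI[OF _ has_vector_derivative_add[OF x(2) z(2)] L2_per_add[OF x(3) z(3)]
          has_ac_derivative_add[OF x(4) z(4)]]) (simp only: x(1) z(1))
qed

lemma H2_per_linear:
  fixes L :: "'a::euclidean_space \<Rightarrow> 'b::euclidean_space"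
  assumes L: "bounded_linear L" and "x \<in> H2_per" shows "(\<lambda>t. L (x t)) \<in> H2_per"
proof (rule H2_perE[OF assms(2)])
  fix w
  assume x: "\<And>t. x (t + 2 * pi) = x t"
      "\<And>t. (x has_vector_derivative vector_derivative x (at t)) (at t)"
      "w \<in> L2_per" "(\<lambda>t. vector_derivative x (at t)) has_ac_derivative w"
  show ?thesis
    by (rule H2_perI[OF _ bounded_linear.has_vector_derivative[OF L x(2)]
          L2_per_linear[OF L x(3)] has_ac_derivative_linear[OF L x(4)]]) (simp only: x(1))
qed

lemma has_vector_derivative_shift:
  assumes "(f has_vector_derivative D) (at (t + \<theta>))"
  shows "((\<lambda>t. f (t + \<theta>)) has_vector_derivative D) (at (t :: real))"
proof -
  have "((\<lambda>t. t + \<theta>) has_vector_derivative 1) (at t)"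
    by (auto intro!: derivative_eq_intros)
  from vector_diff_chain_at[OF this assms] show ?thesis by (simp add: o_def)
qed

lemma H2_per_shift:
  assumes "x \<in> H2_per" shows "(\<lambda>t. x (t + \<theta>)) \<in> H2_per"
proof -
  obtain w where w: "\<And>t. x (t + 2 * pi) = x t"
    "\<And>t. (x has_vector_derivative vector_derivative x (at t)) (at t)"
    "w \<in> L2_per" "(\<lambda>t. vector_derivative x (at t)) has_ac_derivative w"
    using H2_perE[OF assms] by blast
  show ?thesis
  proof (rule H2_perI[OF _ _ L2_per_shift[OF w(3)] has_ac_derivative_shift[OF w(4)]])
    show "x (t + 2 * pi + \<theta>) = x (t + \<theta>)" for t
      using w(1)[of "t + \<theta>"] by (simp add: algebra_simps)
    show "((\<lambda>t. x (t + \<theta>)) has_vector_derivative vector_derivative x (at (t + \<theta>))) (at t)" for t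
      by (rule has_vector_derivative_shift[OF w(2)])
  qed
qed

typedef (overloaded) 'a H2 = "H2_per :: (real \<Rightarrow> 'a::euclidean_space) set"
  morphisms h2_fun Abs_H2
  using H2_per_zero by blast

setup_lifting type_definition_H2

text \<open>
  \<open>h2_deriv\<close> is $x'$, a classical derivative. \<open>h2_deriv2\<close> is a representative of $x'' \in L^2$,
  which is determined up to null sets (\<open>has_ac_derivative_unique\<close>).
\<close>

definition h2_deriv :: "'a::euclidean_space H2 \<Rightarrow> real \<Rightarrow> 'a" where
  "h2_deriv x t = vector_derivative (h2_fun x) (at t)"

definition h2_deriv2 :: "'a::euclidean_space H2 \<Rightarrow> real \<Rightarrow> 'a" where
  "h2_deriv2 x = (SOME w. w \<in> L2_per \<and> h2_deriv x has_ac_derivative w)"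

lemma h2_deriv: "(h2_fun x has_vector_derivative h2_deriv x t) (at t)"
  using h2_fun[of x] by (auto simp: h2_deriv_def elim!: H2_perE)

lemma h2_fun_periodic: "h2_fun x (t + 2 * pi) = h2_fun x t"
  using h2_fun[of x] by (auto elim!: H2_perE)

lemma h2_deriv2: "h2_deriv2 x \<in> L2_per" "h2_deriv x has_ac_derivative h2_deriv2 x"
proof -
  have "\<exists>w. w \<in> L2_per \<and> h2_deriv x has_ac_derivative w"
    using h2_fun[of x] by (auto simp: h2_deriv_def[abs_def] elim!: H2_perE)
  from someI_ex[OF this]
  show "h2_deriv2 x \<in> L2_per" "h2_deriv x has_ac_derivative h2_deriv2 x"
    by (auto simp: h2_deriv2_def)
qed

lemma h2_deriv_eqI:
  assumes "\<And>t. (h2_fun x has_vector_derivative v t) (at t)" shows "h2_deriv x = v"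
  using assms h2_deriv[of x] vector_derivative_at by (metis ext)

lemma h2_deriv2_eqI:
  assumes "h2_deriv x has_ac_derivative w"
  shows "AE t\<in>{0..2 * pi} in lborel. h2_deriv2 x t = w t"
  using has_ac_derivative_unique[OF h2_deriv2(2) assms] .

lemma h2_fun_cont: "continuous_on UNIV (h2_fun x)"
  using h2_deriv by (meson continuous_at_imp_continuous_on has_vector_derivative_continuous)

lemma periodic_continuous_L2_per:
  assumes "\<And>t. f (t + 2 * pi) = f t" "continuous_on UNIV f"
  shows "f \<in> L2_per"
proof -
  have "continuous_on {0..2 * pi} (\<lambda>t. (norm (f t))\<^sup>2)"
    by (intro continuous_intros continuous_on_subset[OF assms(2)]) auto
  then have "set_integrable lborel {0..2 * pi} (\<lambda>t. (norm (f t))\<^sup>2)"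
    by (rule borel_integrable_atLeastAtMost')
  then show ?thesis
    using assms by (auto simp: L2_per_def periodic2pi_iff intro: borel_measurable_continuous_onI)
qed

lemma h2_fun_L2: "h2_fun x \<in> L2_per"
  by (rule periodic_continuous_L2_per[OF h2_fun_periodic h2_fun_cont])

lemma h2_deriv_periodic: "h2_deriv x (t + 2 * pi) = h2_deriv x t"
proof -
  have "((\<lambda>t. h2_fun x (t + 2 * pi)) has_vector_derivative h2_deriv x (t + 2 * pi)) (at t)"
    by (rule has_vector_derivative_shift[OF h2_deriv])
  then show ?thesis
    using h2_deriv[of x t] by (simp add: h2_fun_periodic vector_derivative_unique_at)
qed

lemma h2_deriv_cont: "continuous_on UNIV (h2_deriv x)"
  by (rule has_ac_derivative_continuous[OF h2_deriv2(2)])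

lemma h2_deriv_L2: "h2_deriv x \<in> L2_per"
  by (rule periodic_continuous_L2_per[OF h2_deriv_periodic h2_deriv_cont])

instantiation H2 :: (euclidean_space) real_vector
begin

lift_definition zero_H2 :: "'a H2" is "\<lambda>t. 0" by (rule H2_per_zero)

lift_definition plus_H2 :: "'a H2 \<Rightarrow> 'a H2 \<Rightarrow> 'a H2" is "\<lambda>x z t. x t + z t"
  by (rule H2_per_add)

lift_definition scaleR_H2 :: "real \<Rightarrow> 'a H2 \<Rightarrow> 'a H2" is "\<lambda>r x t. r *\<^sub>R x t"
  by (rule H2_per_linear[OF bounded_linear_scaleR_right])

lift_definition uminus_H2 :: "'a H2 \<Rightarrow> 'a H2" is "\<lambda>x t. - x t"
  by (rule H2_per_linear[OF bounded_linear_minus[OF bounded_linear_ident]])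

definition minus_H2 :: "'a H2 \<Rightarrow> 'a H2 \<Rightarrow> 'a H2" where "minus_H2 x z = x + - z"

instance
  by standard (unfold minus_H2_def, (transfer, simp add: algebra_simps)+)

end

lemma h2_deriv_add: "h2_deriv (x + z) = (\<lambda>t. h2_deriv x t + h2_deriv z t)"
  by (rule h2_deriv_eqI) (auto simp: plus_H2.rep_eq intro!: derivative_intros h2_deriv)

lemma h2_deriv_scaleR: "h2_deriv (r *\<^sub>R x) = (\<lambda>t. r *\<^sub>R h2_deriv x t)"
  by (rule h2_deriv_eqI)
     (auto simp: scaleR_H2.rep_eq
       intro!: bounded_linear.has_vector_derivative[OF bounded_linear_scaleR_right] h2_deriv)

lemma h2_deriv2_add:
  "AE t\<in>{0..2 * pi} in lborel. h2_deriv2 (x + z) t = h2_deriv2 x t + h2_deriv2 z t"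
  by (rule h2_deriv2_eqI)
     (auto simp: h2_deriv_add intro!: has_ac_derivative_add h2_deriv2)

lemma h2_deriv2_scaleR:
  "AE t\<in>{0..2 * pi} in lborel. h2_deriv2 (r *\<^sub>R x) t = r *\<^sub>R h2_deriv2 x t"
  by (rule h2_deriv2_eqI)
     (auto simp: h2_deriv_scaleR
       intro!: has_ac_derivative_linear[OF bounded_linear_scaleR_right] h2_deriv2)

lemma h2_inner_integrable:
  "set_integrable lborel {0..2 * pi}
     (\<lambda>t. h2_deriv2 x t \<bullet> h2_deriv2 z t + h2_deriv x t \<bullet> h2_deriv z t + h2_fun x t \<bullet> h2_fun z t)"
  by (intro set_integral_add L2_per_inner h2_deriv2 h2_deriv_L2 h2_fun_L2)

instantiation H2 :: (euclidean_space) real_inner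
begin

definition inner_H2 :: "'a H2 \<Rightarrow> 'a H2 \<Rightarrow> real" where
  "inner_H2 x z = (LINT t:{0..2 * pi}|lborel.
     h2_deriv2 x t \<bullet> h2_deriv2 z t + h2_deriv x t \<bullet> h2_deriv z t + h2_fun x t \<bullet> h2_fun z t)"

definition norm_H2 :: "'a H2 \<Rightarrow> real" where "norm_H2 x = sqrt (inner x x)"
definition sgn_H2 :: "'a H2 \<Rightarrow> 'a H2" where "sgn_H2 x = x /\<^sub>R norm x"
definition dist_H2 :: "'a H2 \<Rightarrow> 'a H2 \<Rightarrow> real" where "dist_H2 x z = norm (x - z)"
definition uniformity_H2 :: "('a H2 \<times> 'a H2) filter" where
  "uniformity_H2 = (INF e\<in>{0<..}. principal {(x, z). dist x z < e})"
definition open_H2 :: "'a H2 set \<Rightarrow> bool" where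
  "open_H2 U = (\<forall>x\<in>U. eventually (\<lambda>(x', z). x' = x \<longrightarrow> z \<in> U) uniformity)"

instance
proof
  fix x y z :: "'a H2" and r :: real and U :: "'a H2 set"
  show "dist x z = norm (x - z)" by (rule dist_H2_def)
  show "sgn x = x /\<^sub>R norm x" by (rule sgn_H2_def)
  show "uniformity = (INF e\<in>{0<..}. principal {(x::'a H2, z). dist x z < e})"
    by (rule uniformity_H2_def)
  show "open U = (\<forall>x\<in>U. eventually (\<lambda>(x', z). x' = x \<longrightarrow> z \<in> U) uniformity)"
    by (rule open_H2_def)
  show "inner x z = inner z x" by (simp add: inner_H2_def inner_commute)
  show "norm x = sqrt (inner x x)" by (rule norm_H2_def)
  show "inner (x + y) z = inner x z + inner y z"
  proof -
    have "inner (x + y) z = (LINT t:{0..2 * pi}|lborel.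
      (h2_deriv2 x t \<bullet> h2_deriv2 z t + h2_deriv x t \<bullet> h2_deriv z t + h2_fun x t \<bullet> h2_fun z t) +
      (h2_deriv2 y t \<bullet> h2_deriv2 z t + h2_deriv y t \<bullet> h2_deriv z t + h2_fun y t \<bullet> h2_fun z t))"
      unfolding inner_H2_def
    proof (rule set_lebesgue_integral_cong_AE)
      show "AE t\<in>{0..2 * pi} in lborel.
         h2_deriv2 (x + y) t \<bullet> h2_deriv2 z t + h2_deriv (x + y) t \<bullet> h2_deriv z t
           + h2_fun (x + y) t \<bullet> h2_fun z t =
         (h2_deriv2 x t \<bullet> h2_deriv2 z t + h2_deriv x t \<bullet> h2_deriv z t + h2_fun x t \<bullet> h2_fun z t) +
         (h2_deriv2 y t \<bullet> h2_deriv2 z t + h2_deriv y t \<bullet> h2_deriv z t + h2_fun y t \<bullet> h2_fun z t)"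
        using h2_deriv2_add[of x y]
        by eventually_elim (simp add: h2_deriv_add plus_H2.rep_eq inner_add_left)
    qed (use L2_per_measurable[OF h2_deriv2(1)] L2_per_measurable[OF h2_deriv_L2]
        L2_per_measurable[OF h2_fun_L2] in measurable)
    then show ?thesis
      by (simp only: set_integral_add(2)[OF h2_inner_integrable h2_inner_integrable] inner_H2_def)
  qed
  show "inner (r *\<^sub>R x) z = r * inner x z"
  proof -
    have "inner (r *\<^sub>R x) z = (LINT t:{0..2 * pi}|lborel. r *
      (h2_deriv2 x t \<bullet> h2_deriv2 z t + h2_deriv x t \<bullet> h2_deriv z t + h2_fun x t \<bullet> h2_fun z t))"
      unfolding inner_H2_def
    proof (rule set_lebesgue_integral_cong_AE)
      show "AE t\<in>{0..2 * pi} in lborel.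
         h2_deriv2 (r *\<^sub>R x) t \<bullet> h2_deriv2 z t + h2_deriv (r *\<^sub>R x) t \<bullet> h2_deriv z t
           + h2_fun (r *\<^sub>R x) t \<bullet> h2_fun z t = r *
         (h2_deriv2 x t \<bullet> h2_deriv2 z t + h2_deriv x t \<bullet> h2_deriv z t + h2_fun x t \<bullet> h2_fun z t)"
        using h2_deriv2_scaleR[of r x]
        by eventually_elim (simp add: h2_deriv_scaleR scaleR_H2.rep_eq algebra_simps)
    qed (use L2_per_measurable[OF h2_deriv2(1)] L2_per_measurable[OF h2_deriv_L2]
        L2_per_measurable[OF h2_fun_L2] in measurable)
    then show ?thesis by (simp add: inner_H2_def)
  qed
  show nn: "0 \<le> inner x x"
    unfolding inner_H2_def set_lebesgue_integral_def
    by (rule Bochner_Integration.integral_nonneg) (auto simp: indicator_def)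
  show "inner x x = 0 \<longleftrightarrow> x = 0"
  proof
    assume "x = 0"
    have "h2_deriv (0 :: 'a H2) = (\<lambda>t. 0)" "h2_fun (0 :: 'a H2) = (\<lambda>t. 0)"
      using h2_deriv_scaleR[of 0 0] by (auto simp: zero_H2.rep_eq)
    moreover have "AE t\<in>{0..2 * pi} in lborel. h2_deriv2 (0 :: 'a H2) t = 0"
      using h2_deriv2_scaleR[of 0 0] by simp
    ultimately show "inner x x = 0"
      unfolding inner_H2_def set_lebesgue_integral_def \<open>x = 0\<close>
      by (intro integral_eq_zero_AE) (auto elim!: eventually_mono simp: indicator_def)
  next
    assume z: "inner x x = 0"
    have "AE t in lborel. indicat_real {0..2 * pi} t *\<^sub>R (h2_deriv2 x t \<bullet> h2_deriv2 x t
        + h2_deriv x t \<bullet> h2_deriv x t + h2_fun x t \<bullet> h2_fun x t) = 0"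
      using z h2_inner_integrable[of x x]
      unfolding inner_H2_def set_lebesgue_integral_def set_integrable_def
      by (subst integral_nonneg_eq_0_iff_AE[symmetric]) (auto simp: indicator_def)
    then have "AE t in lborel. t \<in> {0<..<2 * pi} \<longrightarrow> h2_fun x t = 0"
    proof eventually_elim
      case (elim t)
      show ?case
      proof
        assume "t \<in> {0<..<2 * pi}"
        then have "h2_deriv2 x t \<bullet> h2_deriv2 x t + h2_deriv x t \<bullet> h2_deriv x t
            + h2_fun x t \<bullet> h2_fun x t = 0"
          using elim by (simp add: indicator_def)
        moreover have "0 \<le> h2_deriv2 x t \<bullet> h2_deriv2 x t" "0 \<le> h2_deriv x t \<bullet> h2_deriv x t"
          "0 \<le> h2_fun x t \<bullet> h2_fun x t" by (rule inner_ge_zero)+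
        ultimately have "h2_fun x t \<bullet> h2_fun x t = 0" by linarith
        then show "h2_fun x t = 0" by simp
      qed
    qed
    then have ae: "AE t in lebesgue. t \<in> {0<..<2 * pi} \<longrightarrow> t \<in> {t. h2_fun x t = 0}"
      by (auto intro: AE_completion)
    have cl: "closed {t. h2_fun x t = 0}"
      by (intro closed_Collect_eq h2_fun_cont continuous_intros)
    have in0: "h2_fun x t = 0" if "t \<in> {0<..<2 * pi}" for t
      using mem_closed_if_AE_lebesgue_open[OF _ cl ae that] by simp
    have "{0..2 * pi} = closure {0<..<2 * pi}" by (simp add: closure_greaterThanLessThan)
    also have "\<dots> \<subseteq> {t. h2_fun x t = 0}"
      using in0 by (intro closure_minimal cl) auto
    finally have in1: "h2_fun x t = 0" if "0 \<le> t" "t \<le> 2 * pi" for t using that by auto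
    interpret p: periodic_fun_simple "h2_fun x" "2 * pi" by standard (rule h2_fun_periodic)
    have "h2_fun x t = 0" for t
    proof -
      define k where "k = \<lfloor>t / (2 * pi)\<rfloor>"
      have "of_int k \<le> t / (2 * pi)" "t / (2 * pi) \<le> of_int k + 1"
        unfolding k_def by (simp_all add: floor_correct less_imp_le)
      then have "h2_fun x (t - of_int k * (2 * pi)) = 0"
        by (intro in1) (auto simp: field_simps)
      then show ?thesis by (simp add: p.minus_of_int)
    qed
    then show "x = 0" by (transfer, auto)
  qed
qed

end


section \<open>The symmetry group $G = D_n \times \mathbb{Z}_2 \times S^1$\<close>

text \<open>
  \<open>'n mod_ring\<close> is $\mathbb{Z}/n$ with $n = $ \<open>CARD('n)\<close>, so \<open>n \<ge> 1\<close> is arbitrary.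
  \<open>D\<^sub>n\<close> is the set of rotations and reflections of this ring of indices. An element of
  $S^1 = \mathbb{R}/2\pi\mathbb{Z}$ is given by a real representative; by periodicity
  \<open>act_H2\<close> depends only on its class (\<open>act_H2_period\<close>).
\<close>

definition dihedral :: "('n::finite mod_ring \<Rightarrow> 'n mod_ring) set" where
  "dihedral = {\<gamma>. \<exists>m. \<gamma> = (\<lambda>k. k + m) \<or> \<gamma> = (\<lambda>k. m - k)}"

definition G_sym :: "(('n::finite mod_ring \<Rightarrow> 'n mod_ring) \<times> real \<times> real) set" where
  "G_sym = dihedral \<times> {1, -1} \<times> UNIV"

definition permute_coords :: "('m::finite \<Rightarrow> 'm) \<Rightarrow> real ^ 'm \<Rightarrow> real ^ 'm" where
  "permute_coords \<gamma> v = (\<chi> k. v $ inv_into UNIV \<gamma> k)"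

lemma bounded_linear_permute: "bounded_linear (\<lambda>v. \<iota> *\<^sub>R permute_coords \<gamma> v)"
  by (intro linear_conv_bounded_linear[THEN iffD1] linearI)
     (auto simp: permute_coords_def vec_eq_iff algebra_simps)

lift_definition act_H2 :: "('m::finite \<Rightarrow> 'm) \<times> real \<times> real \<Rightarrow> (real ^ 'm) H2 \<Rightarrow> (real ^ 'm) H2"
  is "\<lambda>(\<gamma>, \<iota>, \<theta>) x t. \<iota> *\<^sub>R permute_coords \<gamma> (x (t + \<theta>))"
  by (auto intro!: H2_per_linear[OF bounded_linear_permute] H2_per_shift)

lemma act_H2_period: "act_H2 (\<gamma>, \<iota>, \<theta> + 2 * pi) x = act_H2 (\<gamma>, \<iota>, \<theta>) x"
proof -
  have "h2_fun x (t + (\<theta> + 2 * pi)) = h2_fun x (t + \<theta>)" for t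
    using h2_fun_periodic[of x "t + \<theta>"] by (simp add: add.assoc)
  then show ?thesis by (simp add: h2_fun_inject[symmetric] act_H2.rep_eq)
qed


section \<open>The operators\<close>

definition A_op :: "'a::euclidean_space H2 \<Rightarrow> real \<Rightarrow> 'a" where
  "A_op x = (\<lambda>t. h2_deriv2 x t - h2_fun x t)"

text \<open>
  \<open>A_inv\<close> is the inverse of the isomorphism $\mathcal A : \mathcal X \to \mathcal Y$; equality in
  $\mathcal Y$ is equality almost everywhere on $[0,2\pi]$.
\<close>

definition A_inv :: "(real \<Rightarrow> 'a::euclidean_space) \<Rightarrow> 'a H2" where
  "A_inv y = (THE x. AE t\<in>{0..2 * pi} in lborel. A_op x t = y t)"

text \<open>\<open>of_int_mod_ring 1\<close> is $1 \in \mathbb{Z}/n$; the constant \<open>1\<close> is not available for \<open>n = 1\<close>.\<close>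

definition F_op :: "real \<Rightarrow> real \<Rightarrow> real \<Rightarrow> real \<Rightarrow> real \<Rightarrow> real \<times> real \<Rightarrow>
    (real ^ ('n::finite mod_ring)) H2 \<Rightarrow> real \<Rightarrow> real ^ ('n mod_ring)" where
  "F_op \<eta> \<alpha> c \<beta> \<tau>\<^sub>c = (\<lambda>(b, \<tau>\<^sub>0) x t. \<chi> k.
     - \<eta> * h2_deriv x t $ k - \<alpha> * h2_fun x t $ k - b * h2_fun x (t - \<tau>\<^sub>0) $ k
     + c * (h2_fun x (t - \<tau>\<^sub>c) $ (k + of_int_mod_ring 1) - 2 * h2_fun x t $ k
            + h2_fun x (t - \<tau>\<^sub>c) $ (k - of_int_mod_ring 1))
     - \<beta> * (h2_fun x t $ k) ^ 3)"

definition Psi :: "real \<Rightarrow> real \<Rightarrow> real \<Rightarrow> real \<Rightarrow> real \<Rightarrow> real \<times> real \<Rightarrow>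
    (real ^ ('n::finite mod_ring)) H2 \<Rightarrow> (real ^ ('n mod_ring)) H2" where
  "Psi \<eta> \<alpha> c \<beta> \<tau>\<^sub>c p x = x - A_inv (\<lambda>t. F_op \<eta> \<alpha> c \<beta> \<tau>\<^sub>c p x t - h2_fun x t)"

definition param_domain :: "(real \<times> real) set" where
  "param_domain = {0<..} \<times> {0..}"

definition compact_perturbation_of_id :: "('a::real_normed_vector \<Rightarrow> 'a) \<Rightarrow> bool" where
  "compact_perturbation_of_id f \<longleftrightarrow>
     continuous_on UNIV (\<lambda>x. f x - x) \<and>
     (\<forall>B. bounded B \<longrightarrow> compact (closure ((\<lambda>x. f x - x) ` B)))"

end

theory Submission
  imports Defs "HOL-Complex_Analysis.Great_Picard"
begin

text \<open>
  The forcing $\mathscr F_{b,\tau_0}(x) - x$ is continuous and periodic, so $\mathcal A^{-1}$ is only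
  ever applied to continuous functions. There the equation $x'' - x = y$ has a classical periodic
  solution, because $\mathcal A = (D + 1)(D - 1)$ splits into two first-order problems. Integrating
  $(x \cdot x')'$ over a period gives
  $\int |x''|^2 + 2 |x'|^2 + |x|^2 = \int |y|^2$, so this solution is unique and $\mathcal A^{-1}$ is
  Lipschitz from the supremum norm to $\mathcal X$. Each assertion thereby becomes one about uniform
  convergence of the forcing. It depends on $x$ only through $x$ and $x'$, which on a bounded
  subset of $\mathcal X$ are uniformly bounded and equicontinuous, so Arzela--Ascoli yields
  compactness. The dependence on $\tau_0$ is controlled by the Lipschitz constant of $x$.
\<close>

section \<open>The inverse of $\mathcal A$ on continuous functions\<close>

lemma periodic_representative:
  obtains k :: int where "t - of_int k * (2 * pi) \<in> {0..2 * pi}"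
proof
  define k where "k = \<lfloor>t / (2 * pi)\<rfloor>"
  have "of_int k \<le> t / (2 * pi)" "t / (2 * pi) \<le> of_int k + 1"
    unfolding k_def by (simp_all add: floor_correct less_imp_le)
  then show "t - of_int k * (2 * pi) \<in> {0..2 * pi}"
    by (auto simp: field_simps)
qed

lemma periodic_minus_of_int:
  fixes f :: "real \<Rightarrow> 'a"
  assumes "\<And>t. f (t + 2 * pi) = f t"
  shows "f (t - of_int k * (2 * pi)) = f t"
proof -
  interpret periodic_fun_simple f "2 * pi" by standard (rule assms)
  show ?thesis by (rule minus_of_int)
qed

text \<open>Lets an estimate be proved on one period only. It is applied with \<open>P\<close> a
  norm bound, a distance bound, or membership in the image of a period.\<close>

lemma periodic_ball_all:
  fixes f :: "real \<Rightarrow> 'a"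
  assumes "\<And>t. f (t + 2 * pi) = f t" "\<And>t. t \<in> {0..2 * pi} \<Longrightarrow> P (f t)"
  shows "P (f t)"
  using periodic_representative[of t] periodic_minus_of_int[of f, OF assms(1)] assms(2) by metis

section \<open>Classical periodic solutions and absolutely continuous derivatives\<close>

lemma antiderivative_real:
  fixes f :: "real \<Rightarrow> 'a::euclidean_space"
  assumes "continuous_on UNIV f"
  obtains F where "F 0 = 0" "\<And>t. (F has_vector_derivative f t) (at t)"
proof -
  define F where "F = (\<lambda>u. LBINT s=ereal 0..ereal u. f s)"
  have "(F has_vector_derivative f t) (at t)" for t
  proof -
    \<comment> \<open>The interval contains the base point 0 and has t in its interior, so the
      derivative within it is the two-sided derivative.\<close>
    have "(F has_vector_derivative f t) (at t within {- \<bar>t\<bar> - 1..\<bar>t\<bar> + 1})"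
      unfolding F_def
      by (rule interval_integral_FTC2) (auto intro: continuous_on_subset[OF assms])
    moreover have "at t within {- \<bar>t\<bar> - 1..\<bar>t\<bar> + 1} = at t"
      by (rule at_within_interior) (auto simp: abs_if)
    ultimately show ?thesis by simp
  qed
  moreover have "F 0 = 0" by (simp add: F_def)
  ultimately show thesis using that by blast
qed

lemma has_vector_derivative_0_imp_eq:
  fixes f :: "real \<Rightarrow> 'a::euclidean_space"
  assumes "\<And>t. (f has_vector_derivative 0) (at t)"
  shows "f s = f t"
proof -
  obtain c where "\<And>x. x \<in> UNIV \<Longrightarrow> f x = c"
    by (rule has_vector_derivative_zero_constant[of UNIV f]) (use assms in auto)
  then show ?thesis by simp
qed

text \<open>Variation of constants: u(t) = exp(-r t) (C + I(t)) solves u' + r u = y for every C.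
  Since r is nonzero, exp(2 pi r) differs from 1, and C can be chosen so that the values at 0 and 2
  pi agree; uniqueness for the initial value problem then makes u periodic.\<close>

lemma periodic_first_order_ode:
  fixes y :: "real \<Rightarrow> 'a::euclidean_space"
  assumes "r \<noteq> 0" and cont: "continuous_on UNIV y" and per: "\<And>t. y (t + 2 * pi) = y t"
  obtains u where "\<And>t. (u has_vector_derivative y t - r *\<^sub>R u t) (at t)"
    "\<And>t. u (t + 2 * pi) = u t"
proof -
  obtain I where I0: "I 0 = 0"
    and I: "\<And>t. (I has_vector_derivative exp (r * t) *\<^sub>R y t) (at t)"
    by (rule antiderivative_real[of "\<lambda>t. exp (r * t) *\<^sub>R y t"])
       (auto intro!: continuous_intros cont)
  \<comment> \<open>the value at \<open>0\<close> for which \<open>u (2 * pi) = u 0\<close>\<close>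
  define C where "C = (1 / (exp (r * (2 * pi)) - 1)) *\<^sub>R I (2 * pi)"
  define u where "u = (\<lambda>t. exp (- r * t) *\<^sub>R (C + I t))"
  have u: "(u has_vector_derivative y t - r *\<^sub>R u t) (at t)" for t
  proof -
    have "((\<lambda>t. exp (- r * t)) has_real_derivative exp (- r * t) * (- r)) (at t)"
      by (auto intro!: derivative_eq_intros)
    moreover have "((\<lambda>t. C + I t) has_vector_derivative exp (r * t) *\<^sub>R y t) (at t)"
      by (auto intro!: derivative_eq_intros I)
    ultimately have "(u has_vector_derivative exp (- r * t) *\<^sub>R (exp (r * t) *\<^sub>R y t)
        + (exp (- r * t) * (- r)) *\<^sub>R (C + I t)) (at t)"
      unfolding u_def by (rule has_vector_derivative_scaleR)
    moreover have "exp (- r * t) *\<^sub>R (exp (r * t) *\<^sub>R y t)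
        + (exp (- r * t) * (- r)) *\<^sub>R (C + I t) = y t - r *\<^sub>R u t"
      by (simp add: u_def exp_minus_inverse mult.commute)
    ultimately show ?thesis by simp
  qed
  have u0: "u (2 * pi) = u 0"
  proof -
    define E where "E = exp (r * (2 * pi))"
    have "E \<noteq> 1" using assms(1) by (simp add: E_def)
    have "C + I (2 * pi) = E *\<^sub>R C"
    proof -
      have "I (2 * pi) = (E - 1) *\<^sub>R C" using \<open>E \<noteq> 1\<close> by (simp add: C_def flip: E_def)
      then show ?thesis by (simp add: algebra_simps)
    qed
    then have "u (2 * pi) = (exp (- r * (2 * pi)) * E) *\<^sub>R C" by (simp add: u_def)
    also have "exp (- r * (2 * pi)) * E = 1" by (simp add: E_def flip: exp_add)
    finally show ?thesis by (simp add: u_def I0)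
  qed
  \<comment> \<open>The defect \<open>d\<close> vanishes at 0. By periodicity of \<open>y\<close> it
    solves d' = - r d, so exp(r t) d(t) is constant, hence zero.\<close>
  define d where "d = (\<lambda>t. u (t + 2 * pi) - u t)"
  have d: "(d has_vector_derivative - r *\<^sub>R d t) (at t)" for t
  proof -
    have "y (t + 2 * pi) - r *\<^sub>R u (t + 2 * pi) - (y t - r *\<^sub>R u t) = - r *\<^sub>R d t"
      by (simp add: d_def per scaleR_diff_right)
    then show ?thesis
      using has_vector_derivative_diff[OF has_vector_derivative_shift[OF u[of "t + 2 * pi"]] u[of t]]
      by (simp only: d_def)
  qed
  have e: "((\<lambda>t. exp (r * t)) has_real_derivative exp (r * t) * r) (at t)" for t
    by (auto intro!: derivative_eq_intros)
  have "((\<lambda>t. exp (r * t) *\<^sub>R d t) has_vector_derivative 0) (at t)" for t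
    using has_vector_derivative_scaleR[OF e d, of t] by simp
  then have "exp (r * t) *\<^sub>R d t = exp (r * 0) *\<^sub>R d 0" for t
    by (rule has_vector_derivative_0_imp_eq)
  then have "d t = 0" for t using u0 by (simp add: d_def)
  then have "u (t + 2 * pi) = u t" for t by (simp add: d_def)
  then show thesis using u that by blast
qed

lemma has_ac_derivative_C1:
  assumes "\<And>t. (f has_vector_derivative g t) (at t)" "continuous_on UNIV g"
  shows "f has_ac_derivative g"
  unfolding has_ac_derivative_def
proof (intro allI impI)
  fix s t :: real assume "s \<le> t"
  have c: "continuous_on {s..t} g" by (rule continuous_on_subset[OF assms(2)]) simp
  have "(LINT u:{s..t}|lborel. g u) = f t - f s"
    unfolding set_lebesgue_integral_def
    by (rule integral_FTC_Icc[OF \<open>s \<le> t\<close> _ c]) (rule has_vector_derivative_at_within[OF assms(1)])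
  then show "set_integrable lborel {s..t} g \<and> f t - f s = (LINT u:{s..t}|lborel. g u)"
    using borel_integrable_atLeastAtMost'[OF c] by simp
qed

text \<open>Integrals ignore null sets, so on the interval \<open>f\<close> is also a primitive of
  the continuous function \<open>g\<close>, and the fundamental theorem applies. This turns the
  equation almost everywhere into a classical one, so that the product rule becomes available in the
  energy estimate.\<close>

lemma has_ac_derivative_AE_continuous:
  assumes f: "f has_ac_derivative w" and w: "w \<in> borel_measurable borel"
    and ae: "AE t\<in>{a..b} in lborel. w t = g t"
    and g: "continuous_on UNIV g" and t: "t \<in> {a..b}"
  shows "(f has_vector_derivative g t) (at t within {a..b})"
proof -
  have eq: "f s = f a + integral {a..s} g" if "s \<in> {a..b}" for s
  proof -
    have "f s - f a = (LINT u:{a..s}|lborel. w u)"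
      using f that by (auto simp: has_ac_derivative_def)
    also have "\<dots> = (LINT u:{a..s}|lborel. g u)"
      by (rule set_lebesgue_integral_cong_AE)
         (use that ae w borel_measurable_continuous_onI[OF g] in auto)
    also have "\<dots> = integral {a..s} g"
      by (rule set_borel_integral_eq_integral(2), rule borel_integrable_atLeastAtMost')
         (rule continuous_on_subset[OF g], simp)
    finally show ?thesis by (simp add: algebra_simps)
  qed
  have "((\<lambda>u. f a + integral {a..u} g) has_vector_derivative 0 + g t) (at t within {a..b})"
    by (intro has_vector_derivative_add has_vector_derivative_const integral_has_vector_derivative
        continuous_on_subset[OF g] t) simp
  from has_vector_derivative_transform[OF t eq this] show ?thesis by simp
qed

text \<open>First u' + u = y is solved, then x' - x = u, both with periodic solutions. Then x' = u +
  x and x'' = (y - u) + (u + x) = y + x.\<close>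

lemma H2_exists_solution:
  fixes y :: "real \<Rightarrow> 'a::euclidean_space"
  assumes cont: "continuous_on UNIV y" and per: "\<And>t. y (t + 2 * pi) = y t"
  obtains z where "\<And>t. (h2_deriv z has_vector_derivative y t + h2_fun z t) (at t)"
proof -
  obtain u where u: "\<And>t. (u has_vector_derivative y t - 1 *\<^sub>R u t) (at t)"
    and pu: "\<And>t. u (t + 2 * pi) = u t"
    by (rule periodic_first_order_ode[of 1 y]) (use assms in auto)
  have cu: "continuous_on UNIV u"
    using u by (meson continuous_at_imp_continuous_on has_vector_derivative_continuous)
  obtain x where x: "\<And>t. (x has_vector_derivative u t - (- 1) *\<^sub>R x t) (at t)"
    and px: "\<And>t. x (t + 2 * pi) = x t"
    by (rule periodic_first_order_ode[of "- 1" u]) (use cu pu in auto)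
  have cx: "continuous_on UNIV x"
    using x by (meson continuous_at_imp_continuous_on has_vector_derivative_continuous)
  have x': "(x has_vector_derivative u t + x t) (at t)" for t using x[of t] by simp
  have x'': "((\<lambda>t. u t + x t) has_vector_derivative y t + x t) (at t)" for t
    using has_vector_derivative_add[OF u[of t] x[of t]] by simp
  have w: "(\<lambda>t. y t + x t) \<in> L2_per"
    by (rule periodic_continuous_L2_per) (simp only: per px, intro continuous_intros cont cx)
  have "x \<in> H2_per"
    by (rule H2_perI[OF px x' w]) (rule has_ac_derivative_C1[OF x''], intro continuous_intros cont cx)
  then have "h2_fun (Abs_H2 x) = x" by (rule Abs_H2_inverse)
  moreover from this have "h2_deriv (Abs_H2 x) = (\<lambda>t. u t + x t)"
    by (intro h2_deriv_eqI) (simp only: x')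
  ultimately show thesis by (intro that[of "Abs_H2 x"]) (simp only: x'')
qed

section \<open>Energy estimate and uniqueness\<close>

text \<open>With u = x, v = x' and v' = y + u, the function q = (v . u)' integrates to 0 over a
  period. The integrand of the squared norm equals |y|^2 + 2 q - |v|^2, so the squared norm is at
  most 2 pi M^2; the constant 3 is sqrt(2 pi) rounded up.\<close>

lemma h2_norm_le_A_op:
  fixes x :: "'a::euclidean_space H2"
  assumes ae: "AE t\<in>{0..2 * pi} in lborel. A_op x t = y t"
    and y: "continuous_on UNIV y" and M: "\<And>t. t \<in> {0..2 * pi} \<Longrightarrow> norm (y t) \<le> M" "0 \<le> M"
  shows "norm x \<le> 3 * M"
proof -
  define u v where "u = h2_fun x" and "v = h2_deriv x"
  have cu: "continuous_on UNIV u" and cv: "continuous_on UNIV v"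
    by (simp_all add: u_def v_def h2_fun_cont h2_deriv_cont)
  have c: "continuous_on {0..2 * pi} u" "continuous_on {0..2 * pi} v" "continuous_on {0..2 * pi} y"
    by (rule continuous_on_subset[OF cu] continuous_on_subset[OF cv] continuous_on_subset[OF y], simp)+
  have ae': "AE t\<in>{0..2 * pi} in lborel. h2_deriv2 x t = y t + u t"
    using ae by eventually_elim (auto simp: A_op_def u_def algebra_simps)
  have v': "(v has_vector_derivative y t + u t) (at t within {0..2 * pi})" if "t \<in> {0..2 * pi}" for t
    unfolding v_def
    by (rule has_ac_derivative_AE_continuous[OF h2_deriv2(2) _ ae' _ that])
       (use h2_deriv2(1) y cu in \<open>auto simp: L2_per_def intro!: continuous_intros\<close>)
  have u': "(u has_vector_derivative v t) (at t within {0..2 * pi})" for t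
    unfolding u_def v_def by (rule has_vector_derivative_at_within[OF h2_deriv])
  define q where "q = (\<lambda>t. v t \<bullet> v t + (y t + u t) \<bullet> u t)"
  have q: "(LINT t:{0..2 * pi}|lborel. q t) = v (2 * pi) \<bullet> u (2 * pi) - v 0 \<bullet> u 0"
    unfolding set_lebesgue_integral_def
  proof (rule integral_FTC_Icc)
    show "continuous_on {0..2 * pi} q" unfolding q_def by (intro continuous_intros c)
    show "((\<lambda>t. v t \<bullet> u t) has_vector_derivative q t) (at t within {0..2 * pi})"
      if "0 \<le> t" "t \<le> 2 * pi" for t
      using bounded_bilinear.has_vector_derivative[OF bounded_bilinear_inner v'[of t] u'[of t]] that
      by (simp add: q_def)
  qed simp
  have per: "v (2 * pi) = v 0" "u (2 * pi) = u 0"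
    using h2_deriv_periodic[of x 0] h2_fun_periodic[of x 0] by (simp_all add: u_def v_def)
  have qi: "set_integrable lborel {0..2 * pi} q"
    unfolding q_def by (intro borel_integrable_atLeastAtMost' continuous_intros c)
  have "inner x x = (LINT t:{0..2 * pi}|lborel. (y t + u t) \<bullet> (y t + u t) + v t \<bullet> v t + u t \<bullet> u t)"
    unfolding inner_H2_def
  proof (rule set_lebesgue_integral_cong_AE)
    show "AE t\<in>{0..2 * pi} in lborel. h2_deriv2 x t \<bullet> h2_deriv2 x t + h2_deriv x t \<bullet> h2_deriv x t
      + h2_fun x t \<bullet> h2_fun x t = (y t + u t) \<bullet> (y t + u t) + v t \<bullet> v t + u t \<bullet> u t"
      using ae' by eventually_elim (simp add: u_def v_def)
  qed (use L2_per_measurable[OF h2_deriv2(1)] L2_per_measurable[OF h2_deriv_L2]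
        L2_per_measurable[OF h2_fun_L2] borel_measurable_continuous_onI[OF y]
        borel_measurable_continuous_onI[OF cu] borel_measurable_continuous_onI[OF cv] in measurable)
  also have "\<dots> \<le> (LINT t:{0..2 * pi}|lborel. M\<^sup>2 + 2 * q t)"
  proof (rule set_integral_mono)
    fix t assume t: "t \<in> {0..2 * pi}"
    have "y t \<bullet> y t \<le> M\<^sup>2"
      using power_mono[OF M(1)[OF t], of 2] by (simp add: power2_norm_eq_inner)
    moreover have "0 \<le> v t \<bullet> v t" by (rule inner_ge_zero)
    \<comment> \<open>The mixed term 2 y . u has no sign; it is absorbed into 2 q, whose integral
      vanishes.\<close>
    moreover have "(y t + u t) \<bullet> (y t + u t) + v t \<bullet> v t + u t \<bullet> u t
        = y t \<bullet> y t + 2 * q t - v t \<bullet> v t"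
      by (simp add: q_def inner_add algebra_simps inner_commute)
    ultimately show "(y t + u t) \<bullet> (y t + u t) + v t \<bullet> v t + u t \<bullet> u t \<le> M\<^sup>2 + 2 * q t"
      by linarith
  qed (intro borel_integrable_atLeastAtMost' continuous_intros c set_integral_add(1)
        set_integrable_mult_right qi)+
  also have "\<dots> = (LINT t:{0..2 * pi}|lborel. M\<^sup>2) + 2 * (LINT t:{0..2 * pi}|lborel. q t)"
    by (subst set_integral_add) (auto intro!: set_integrable_mult_right qi borel_integrable_atLeastAtMost')
  also have "\<dots> = 2 * pi * M\<^sup>2" unfolding q per by (simp add: set_lebesgue_integral_def)
  also have "\<dots> \<le> 9 * M\<^sup>2"
    using pi_less_4 pi_approx by (intro mult_right_mono) auto
  also have "\<dots> = (3 * M)\<^sup>2" by (simp add: power2_eq_square)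
  finally show ?thesis
    using M(2) by (simp add: norm_H2_def real_sqrt_le_iff real_le_lsqrt)
qed

lemma h2_fun_diff: "h2_fun (x - z) t = h2_fun x t - h2_fun z t"
  by (simp only: minus_H2_def plus_H2.rep_eq uminus_H2.rep_eq) simp

lemma h2_deriv_diff: "h2_deriv (x - z) t = h2_deriv x t - h2_deriv z t"
  using h2_deriv_add[of x "(- 1) *\<^sub>R z"] h2_deriv_scaleR[of "- 1" z] by simp

text \<open>\<open>h2_deriv2\<close> is a chosen representative of x'', so \<open>A_op\<close>
  respects differences only up to a null set. The difference is written as x + (-1) z in order to
  use additivity and homogeneity.\<close>

lemma A_op_diff:
  "AE t\<in>{0..2 * pi} in lborel. A_op (x - z) t = A_op x t - A_op z t"
proof -
  have e: "x + (- 1) *\<^sub>R z = x - z" by simp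
  show ?thesis
    using h2_deriv2_add[of x "(- 1) *\<^sub>R z", unfolded e] h2_deriv2_scaleR[of "- 1" z]
  proof eventually_elim
    case (elim t)
    show ?case
    proof
      assume "t \<in> {0..2 * pi}"
      then have "h2_deriv2 (x - z) t = h2_deriv2 x t + (- 1) *\<^sub>R h2_deriv2 z t"
        using elim by metis
      then show "A_op (x - z) t = A_op x t - A_op z t"
        unfolding A_op_def h2_fun_diff by simp
    qed
  qed
qed

text \<open>Linearity carries the energy estimate over to differences. The case M = 0 is uniqueness;
  for two classical solutions this is the Lipschitz bound for \<open>A_inv\<close>.\<close>

lemma A_op_AE_diff_le:
  assumes "AE t\<in>{0..2 * pi} in lborel. A_op x t = y t" "AE t\<in>{0..2 * pi} in lborel. A_op z t = w t"
    and "continuous_on UNIV y" "continuous_on UNIV w"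
    and "\<And>t. t \<in> {0..2 * pi} \<Longrightarrow> norm (y t - w t) \<le> M" "0 \<le> M"
  shows "norm (x - z) \<le> 3 * M"
proof (rule h2_norm_le_A_op[where y = "\<lambda>t. y t - w t"])
  show "AE t\<in>{0..2 * pi} in lborel. A_op (x - z) t = y t - w t"
    using A_op_diff[of x z] assms(1,2) by eventually_elim auto
qed (rule continuous_on_diff assms | assumption)+

lemma A_op_AE_unique:
  assumes "AE t\<in>{0..2 * pi} in lborel. A_op x t = y t" "AE t\<in>{0..2 * pi} in lborel. A_op z t = y t"
    and "continuous_on UNIV y"
  shows "x = z"
  using A_op_AE_diff_le[OF assms(1,2,3,3), of 0] by simp

section \<open>\<open>A_inv\<close> as the classical solution operator\<close>

lemma A_op_AE_classical:
  assumes "\<And>t. (h2_deriv z has_vector_derivative y t + h2_fun z t) (at t)" "continuous_on UNIV y"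
  shows "AE t\<in>{0..2 * pi} in lborel. A_op z t = y t"
proof -
  have "h2_deriv z has_ac_derivative (\<lambda>t. y t + h2_fun z t)"
    by (rule has_ac_derivative_C1[OF assms(1)]) (intro continuous_intros assms h2_fun_cont)
  from h2_deriv2_eqI[OF this] show ?thesis by eventually_elim (simp add: A_op_def)
qed

text \<open>Resolves the definite description in \<open>A_inv\<close>: a classical solution
  satisfies the equation almost everywhere, and the energy estimate excludes any other element. To
  compute \<open>A_inv\<close> it therefore suffices to exhibit a classical solution.\<close>

lemma A_inv_eqI:
  assumes "\<And>t. (h2_deriv z has_vector_derivative y t + h2_fun z t) (at t)" "continuous_on UNIV y"
  shows "A_inv y = z"
  unfolding A_inv_def
  by (rule the_equality[where P = "\<lambda>x. AE t\<in>{0..2 * pi} in lborel. A_op x t = y t"])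
     (rule A_op_AE_classical[OF assms] A_op_AE_unique[OF _ _ assms(2)], assumption?)+

lemma A_inv_solves:
  assumes "continuous_on UNIV y" "\<And>t. y (t + 2 * pi) = y t"
  shows "(h2_deriv (A_inv y) has_vector_derivative y t + h2_fun (A_inv y) t) (at t)"
proof -
  obtain z where z: "\<And>t. (h2_deriv z has_vector_derivative y t + h2_fun z t) (at t)"
    using H2_exists_solution[OF assms] by blast
  then show ?thesis using A_inv_eqI[OF z assms(1)] by simp
qed

lemma A_inv_diff_le:
  assumes "continuous_on UNIV y" "\<And>t. y (t + 2 * pi) = y t"
    and "continuous_on UNIV w" "\<And>t. w (t + 2 * pi) = w t"
    and "\<And>t. norm (y t - w t) \<le> M" "0 \<le> M"
  shows "norm (A_inv y - A_inv w) \<le> 3 * M"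
  by (rule A_op_AE_diff_le[OF A_op_AE_classical[OF A_inv_solves[OF assms(1,2)] assms(1)]
      A_op_AE_classical[OF A_inv_solves[OF assms(3,4)] assms(3)] assms(1,3,5,6)])

section \<open>The embedding of $H^2_{\mathrm{per}}$ into $C^1$\<close>

text \<open>Provides the equicontinuity for Arzela-Ascoli, since the modulus depends on
  \<open>f\<close> only through \<open>R\<close>. It is applied to the pairs (x, x') and (x',
  x'').\<close>

lemma has_ac_derivative_L2_Hoelder:
  fixes f g :: "real \<Rightarrow> 'a::euclidean_space"
  assumes f: "f has_ac_derivative g" and g: "g \<in> L2_per"
    and R: "(LINT t:{0..2 * pi}|lborel. (norm (g t))\<^sup>2) \<le> R\<^sup>2" "0 \<le> R"
    and st: "0 \<le> s" "s \<le> t" "t \<le> 2 * pi"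
  shows "norm (f t - f s) \<le> R * sqrt (t - s)"
proof (cases "s = t")
  case False
  define L where "L = t - s"
  have L: "L > 0" using st False by (simp add: L_def)
  \<comment> \<open>Cauchy--Schwarz, in the form that the integral of $|g - m|^2$ is nonnegative for the mean \<open>m\<close> of \<open>g\<close>.\<close>
  define m where "m = (1 / L) *\<^sub>R (f t - f s)"
  have "(\<lambda>t. m \<bullet> f t) has_ac_derivative (\<lambda>t. m \<bullet> g t)"
    by (rule has_ac_derivative_linear[OF bounded_linear_inner_right f])
  then have i: "set_integrable lborel {s..t} (\<lambda>u. m \<bullet> g u)"
    and e: "(LINT u:{s..t}|lborel. m \<bullet> g u) = m \<bullet> f t - m \<bullet> f s"
    using st by (auto simp: has_ac_derivative_def)
  have ic: "set_integrable lborel {s..t} (\<lambda>u. c)" for c :: real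
    by (intro borel_integrable_atLeastAtMost' continuous_intros)
  have ig: "set_integrable lborel {0..2 * pi} (\<lambda>t. (norm (g t))\<^sup>2)"
    using g by (simp add: L2_per_def)
  have i': "set_integrable lborel {s..t} (\<lambda>u. 2 * (m \<bullet> g u) - m \<bullet> m)"
    by (intro set_integral_diff(1) set_integrable_mult_right i ic)
  have "m \<bullet> f t - m \<bullet> f s = (norm (f t - f s))\<^sup>2 / L"
    unfolding inner_diff_right[symmetric] by (simp add: m_def power2_norm_eq_inner)
  moreover have "L * (m \<bullet> m) = (norm (f t - f s))\<^sup>2 / L"
    using L by (simp add: m_def power2_norm_eq_inner)
  moreover have "(LINT u:{s..t}|lborel. m \<bullet> m) = L * (m \<bullet> m)"
    using st by (simp add: set_lebesgue_integral_def L_def)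
  moreover have "(LINT u:{s..t}|lborel. 2 * (m \<bullet> g u) - m \<bullet> m)
      = 2 * (LINT u:{s..t}|lborel. m \<bullet> g u) - (LINT u:{s..t}|lborel. m \<bullet> m)"
    by (subst set_integral_diff(2)[OF set_integrable_mult_right[OF i] ic]) simp
  \<comment> \<open>The integral of \<open>g\<close> over [s, t] is L m, so the right side is 2 L
    |m|^2 - L |m|^2 = L |m|^2.\<close>
  ultimately have "(norm (f t - f s))\<^sup>2 / L = (LINT u:{s..t}|lborel. 2 * (m \<bullet> g u) - m \<bullet> m)"
    unfolding e by (simp only:)
  also have "\<dots> \<le> (LINT t:{0..2 * pi}|lborel. (norm (g t))\<^sup>2)"
    unfolding set_lebesgue_integral_def
  proof (rule integral_mono)
    fix u
    have "0 \<le> (g u - m) \<bullet> (g u - m)" by (rule inner_ge_zero)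
    then have "2 * (m \<bullet> g u) - m \<bullet> m \<le> (norm (g u))\<^sup>2"
      by (simp add: power2_norm_eq_inner inner_diff inner_commute)
    then show "indicat_real {s..t} u *\<^sub>R (2 * (m \<bullet> g u) - m \<bullet> m)
        \<le> indicat_real {0..2 * pi} u *\<^sub>R (norm (g u))\<^sup>2"
      using st by (auto simp: indicator_def)
  qed (use i' ig in \<open>simp_all add: set_integrable_def\<close>)
  also note R(1)
  finally have "(norm (f t - f s))\<^sup>2 \<le> R\<^sup>2 * L"
    using L by (simp add: field_simps)
  also have "\<dots> = (R * sqrt L)\<^sup>2" using L by (simp add: power_mult_distrib)
  finally show ?thesis
    unfolding L_def by (rule power2_le_imp_le) (use R st in auto)
qed simp

text \<open>On one period \<open>f\<close> varies by at most R sqrt(2 pi) \<le> 3 R. If |f| exceeded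
  4 R at some point of it, then |f| would stay above R throughout the period, and the integral of
  |f|^2 would exceed R^2.\<close>

lemma has_ac_derivative_L2_sup_le:
  fixes f g :: "real \<Rightarrow> 'a::euclidean_space"
  assumes f: "f has_ac_derivative g" and g: "g \<in> L2_per" and fL: "f \<in> L2_per"
    and R: "(LINT t:{0..2 * pi}|lborel. (norm (g t))\<^sup>2) \<le> R\<^sup>2"
      "(LINT t:{0..2 * pi}|lborel. (norm (f t))\<^sup>2) \<le> R\<^sup>2" "0 \<le> R"
  shows "norm (f t) \<le> 4 * R"
proof -
  have "norm (f t) \<le> 4 * R" if t: "t \<in> {0..2 * pi}" for t
  proof (rule ccontr)
    assume "\<not> norm (f t) \<le> 4 * R"
    then have gt: "norm (f t) > 4 * R" by simp
    define m where "m = norm (f t) - 3 * R"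
    have m: "m > R" using gt by (simp add: m_def)
    have sq: "sqrt d \<le> 3" if "d \<le> 2 * pi" for d
      using that pi_less_4 pi_approx by (intro real_le_lsqrt) auto
    have lower: "m \<le> norm (f s)" if s: "s \<in> {0..2 * pi}" for s
    proof -
      have "norm (f t - f s) \<le> R * 3"
      proof (cases "s \<le> t")
        case True
        have "norm (f t - f s) \<le> R * sqrt (t - s)"
          by (rule has_ac_derivative_L2_Hoelder[OF f g R(1,3)]) (use s t True in auto)
        also have "\<dots> \<le> R * 3" using R(3) s t by (intro mult_left_mono sq) auto
        finally show ?thesis .
      next
        case False
        have "norm (f s - f t) \<le> R * sqrt (s - t)"
          by (rule has_ac_derivative_L2_Hoelder[OF f g R(1,3)]) (use s t False in auto)
        also have "\<dots> \<le> R * 3" using R(3) s t by (intro mult_left_mono sq) auto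
        finally show ?thesis by (simp add: norm_minus_commute)
      qed
      then show ?thesis using norm_triangle_ineq2[of "f t" "f s"] by (simp add: m_def)
    qed
    have "2 * pi * m\<^sup>2 = (LINT t:{0..2 * pi}|lborel. m\<^sup>2)"
      by (simp add: set_lebesgue_integral_def)
    also have "\<dots> \<le> (LINT t:{0..2 * pi}|lborel. (norm (f t))\<^sup>2)"
      by (rule set_integral_mono)
         (use fL lower m R(3) in \<open>auto simp: L2_per_def intro!: borel_integrable_atLeastAtMost' power_mono\<close>)
    also note R(2)
    finally have "2 * pi * m\<^sup>2 \<le> R\<^sup>2" .
    moreover have "R\<^sup>2 < m\<^sup>2" using m R(3) by (intro power_strict_mono) auto
    moreover have "1 * m\<^sup>2 \<le> 2 * pi * m\<^sup>2" using pi_gt3 by (intro mult_right_mono) auto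
    ultimately show False by linarith
  qed
  then show ?thesis
    using periodic_ball_all[of f "\<lambda>v. norm v \<le> 4 * R"] fL by (auto simp: L2_per_def periodic2pi_iff)
qed

lemma h2_L2_norms_le:
  "(LINT t:{0..2 * pi}|lborel. (norm (h2_fun x t))\<^sup>2) \<le> (norm x)\<^sup>2" (is "?A \<le> _")
  "(LINT t:{0..2 * pi}|lborel. (norm (h2_deriv x t))\<^sup>2) \<le> (norm x)\<^sup>2" (is "?B \<le> _")
  "(LINT t:{0..2 * pi}|lborel. (norm (h2_deriv2 x t))\<^sup>2) \<le> (norm x)\<^sup>2" (is "?C \<le> _")
proof -
  have i: "set_integrable lborel {0..2 * pi} (\<lambda>t. h2_fun x t \<bullet> h2_fun x t)"
    "set_integrable lborel {0..2 * pi} (\<lambda>t. h2_deriv x t \<bullet> h2_deriv x t)"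
    "set_integrable lborel {0..2 * pi} (\<lambda>t. h2_deriv2 x t \<bullet> h2_deriv2 x t)"
    by (intro L2_per_inner h2_deriv2 h2_deriv_L2 h2_fun_L2)+
  have "(norm x)\<^sup>2 = ?C + ?B + ?A"
    unfolding power2_norm_eq_inner inner_H2_def
    using i by (simp add: set_integral_add)
  moreover have "0 \<le> ?A" "0 \<le> ?B" "0 \<le> ?C"
    by (auto simp: set_lebesgue_integral_def intro!: Bochner_Integration.integral_nonneg)
  ultimately show "?A \<le> (norm x)\<^sup>2" "?B \<le> (norm x)\<^sup>2" "?C \<le> (norm x)\<^sup>2" by linarith+
qed

lemma h2_fun_ac: "h2_fun x has_ac_derivative h2_deriv x"
  by (rule has_ac_derivative_C1[OF h2_deriv h2_deriv_cont])

lemma norm_h2_fun_le: "norm (h2_fun x t) \<le> 4 * norm x"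
  by (rule has_ac_derivative_L2_sup_le[OF h2_fun_ac h2_deriv_L2 h2_fun_L2 h2_L2_norms_le(2,1) norm_ge_zero])

lemma norm_h2_deriv_le: "norm (h2_deriv x t) \<le> 4 * norm x"
  by (rule has_ac_derivative_L2_sup_le[OF h2_deriv2(2,1) h2_deriv_L2 h2_L2_norms_le(3,2) norm_ge_zero])

lemma h2_fun_Lipschitz: "norm (h2_fun x t - h2_fun x s) \<le> 4 * norm x * \<bar>t - s\<bar>"
proof -
  have "norm (h2_fun x t - h2_fun x s) \<le> 4 * norm x * norm (t - s)"
  proof (rule differentiable_bound[of UNIV "h2_fun x" "\<lambda>t d. d *\<^sub>R h2_deriv x t"])
    show "(h2_fun x has_derivative (\<lambda>d. d *\<^sub>R h2_deriv x t)) (at t within UNIV)" for t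
      using h2_deriv[of x t] by (simp add: has_vector_derivative_def)
    show "onorm (\<lambda>d. d *\<^sub>R h2_deriv x t) \<le> 4 * norm x" for t
      using norm_h2_deriv_le[of x t] by (intro onorm_le) (auto simp: mult.commute mult_left_mono)
  qed auto
  then show ?thesis by simp
qed

section \<open>Uniform limits of periodic functions\<close>

lemma uniform_limit_Pair:
  fixes f :: "'i \<Rightarrow> 'x \<Rightarrow> 'a::metric_space" and g :: "'i \<Rightarrow> 'x \<Rightarrow> 'b::metric_space"
  assumes "uniform_limit A f l F" "uniform_limit A g m F"
  shows "uniform_limit A (\<lambda>n x. (f n x, g n x)) (\<lambda>x. (l x, m x)) F"
proof (rule uniform_limitI)
  fix e :: real assume "0 < e"
  then have "\<forall>\<^sub>F n in F. \<forall>x\<in>A. dist (f n x) (l x) < e / 2" "\<forall>\<^sub>F n in F. \<forall>x\<in>A. dist (g n x) (m x) < e / 2"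
    using assms by (auto dest!: uniform_limitD[where e = "e / 2"])
  then show "\<forall>\<^sub>F n in F. \<forall>x\<in>A. dist (f n x, g n x) (l x, m x) < e"
  proof eventually_elim
    case (elim n)
    show ?case
    proof
      fix x assume "x \<in> A"
      have "dist (f n x, g n x) (l x, m x) \<le> dist (f n x) (l x) + dist (g n x) (m x)"
        by (simp add: dist_Pair_Pair sqrt_sum_squares_le_sum)
      also have "\<dots> < e / 2 + e / 2" using elim \<open>x \<in> A\<close> by (intro add_strict_mono) auto
      finally show "dist (f n x, g n x) (l x, m x) < e" by simp
    qed
  qed
qed

text \<open>A continuous \<open>h\<close> is uniformly continuous on closed balls. As
  \<open>l\<close> is bounded by some M on A, the approximating functions eventually take values in
  the ball of radius M + 1.\<close>

lemma uniform_limit_continuous_compose: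
  fixes h :: "'a::{heine_borel,real_normed_vector} \<Rightarrow> 'b::metric_space"
  assumes lim: "uniform_limit A g l F" and h: "continuous_on UNIV h" and b: "bounded (l ` A)"
  shows "uniform_limit A (\<lambda>n x. h (g n x)) (\<lambda>x. h (l x)) F"
proof -
  obtain M where M: "\<And>x. x \<in> A \<Longrightarrow> norm (l x) \<le> M"
    using b by (auto simp: bounded_iff)
  show ?thesis
  proof (rule uniform_limit_compose_uniformly_continuous_on[OF lim])
    show "uniformly_continuous_on (cball 0 (M + 1)) h"
      by (rule compact_uniformly_continuous) (auto intro: continuous_on_subset[OF h])
    show "\<forall>\<^sub>F n in F. \<forall>x\<in>A. g n x \<in> cball 0 (M + 1)"
      using uniform_limitD[OF lim zero_less_one]
    proof eventually_elim
      case (elim n)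
      show ?case
      proof
        fix x assume "x \<in> A"
        then have "norm (g n x - l x) < 1" using elim by (simp add: dist_norm)
        then show "g n x \<in> cball 0 (M + 1)"
          using M[OF \<open>x \<in> A\<close>] norm_triangle_ineq2[of "g n x" "l x"] by simp
      qed
    qed
  qed simp
qed

lemma periodic_Arzela_Ascoli:
  fixes f :: "nat \<Rightarrow> real \<Rightarrow> 'a::euclidean_space"
  assumes per: "\<And>n t. f n (t + 2 * pi) = f n t" and M: "\<And>n t. norm (f n t) \<le> M"
    and osc: "\<And>n s t. 0 \<le> s \<Longrightarrow> s \<le> t \<Longrightarrow> t \<le> 2 * pi \<Longrightarrow> norm (f n t - f n s) \<le> C * sqrt (t - s)"
    and "0 \<le> C"
  obtains g k where "strict_mono (k :: nat \<Rightarrow> nat)" "uniform_limit UNIV (\<lambda>n. f (k n)) g sequentially"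
proof -
  have osc': "norm (f n s - f n t) \<le> C * sqrt \<bar>s - t\<bar>" if "s \<in> {0..2 * pi}" "t \<in> {0..2 * pi}" for n s t
    using that osc[of s t n] osc[of t s n] by (cases "s \<le> t") (auto simp: norm_minus_commute)
  obtain g k where k: "strict_mono (k :: nat \<Rightarrow> nat)"
    and g: "\<And>e. 0 < e \<Longrightarrow> \<exists>N. \<forall>n x. n \<ge> N \<and> x \<in> {0..2 * pi} \<longrightarrow> norm (f (k n) x - g x) < e"
  proof (rule Arzela_Ascoli[of "{0..2 * pi}" f M])
    fix x e :: real assume x: "x \<in> {0..2 * pi}" and e: "0 < e"
    \<comment> \<open>Dividing by C + 1 covers the case C = 0 and leaves C e / (C + 1) strictly
      below e.\<close>
    define d where "d = (e / (C + 1))\<^sup>2"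
    have "norm (f n x - f n y) < e" if y: "y \<in> {0..2 * pi}" "norm (x - y) < d" for n y
    proof -
      have "norm (f n x - f n y) \<le> C * sqrt \<bar>x - y\<bar>" by (rule osc'[OF x y(1)])
      also have "\<dots> \<le> C * sqrt d" using y(2) \<open>0 \<le> C\<close> by (intro mult_left_mono) auto
      also have "\<dots> = C * (e / (C + 1))" using e \<open>0 \<le> C\<close> by (simp add: d_def)
      also have "\<dots> < e" using e \<open>0 \<le> C\<close> by (simp add: field_simps)
      finally show ?thesis .
    qed
    moreover have "0 < d" using e \<open>0 \<le> C\<close> by (simp add: d_def)
    ultimately show "\<exists>d. 0 < d \<and> (\<forall>n y. y \<in> {0..2 * pi} \<and> norm (x - y) < d \<longrightarrow> norm (f n x - f n y) < e)"
      by blast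
  qed (use M in auto)
  \<comment> \<open>The limit \<open>g\<close> is controlled on [0, 2 pi] only. The Cauchy property,
    by contrast, passes to the whole line by periodicity of the \<open>f n\<close> and yields a
    limit there.\<close>
  have "uniformly_Cauchy_on UNIV (\<lambda>n. f (k n))"
  proof (rule uniformly_Cauchy_onI)
    fix e :: real assume "0 < e"
    then obtain N where N: "\<And>n x. n \<ge> N \<Longrightarrow> x \<in> {0..2 * pi} \<Longrightarrow> norm (f (k n) x - g x) < e / 2"
      using g[of "e / 2"] by auto
    have "dist (f (k m) t) (f (k n) t) < e" if "m \<ge> N" "n \<ge> N" for m n t
    proof (rule periodic_ball_all[of "\<lambda>t. dist (f (k m) t) (f (k n) t)" "\<lambda>d. d < e"])
      fix t :: real assume "t \<in> {0..2 * pi}"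
      then show "dist (f (k m) t) (f (k n) t) < e"
        using dist_triangle_half_l[of "f (k m) t" "g t" e "f (k n) t"] N that by (auto simp: dist_norm)
    qed (simp add: per)
    then show "\<exists>N. \<forall>x\<in>UNIV. \<forall>m\<ge>N. \<forall>n\<ge>N. dist (f (k m) x) (f (k n) x) < e" by blast
  qed
  then obtain l where "uniform_limit UNIV (\<lambda>n. f (k n)) l sequentially"
    using Cauchy_uniformly_convergent unfolding uniformly_convergent_on_def by blast
  with k that show thesis by blast
qed

lemma periodic_uniform_limit:
  assumes "uniform_limit UNIV f l sequentially" "\<And>n t. f n (t + 2 * pi) = f n t"
  shows "l (t + 2 * pi) = l t"
proof -
  have "(\<lambda>n. f n s) \<longlonglongrightarrow> l s" for s by (rule tendsto_uniform_limitI[OF assms(1)]) simp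
  from this[of "t + 2 * pi"] this[of t] show ?thesis
    unfolding assms(2) by (rule LIMSEQ_unique)
qed

lemma continuous_periodic_bounded:
  fixes f :: "real \<Rightarrow> 'a::metric_space"
  assumes "continuous_on UNIV f" "\<And>t. f (t + 2 * pi) = f t"
  shows "bounded (range f)"
proof -
  have "range f \<subseteq> f ` {0..2 * pi}"
    using periodic_ball_all[of f "\<lambda>v. v \<in> f ` {0..2 * pi}", OF assms(2)] by auto
  moreover have "compact (f ` {0..2 * pi})"
    by (rule compact_continuous_image) (auto intro: continuous_on_subset[OF assms(1)])
  ultimately show ?thesis using bounded_subset compact_imp_bounded by blast
qed

text \<open>Each point of a sequence in the closure is replaced by a point of S at distance below
  1/(n+1); along any subsequence both sequences have the same limits. Thus subsequences need to be
  extracted only from sequences in S, with no condition on where the limit lies.\<close>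

lemma compact_closure_sequentialI:
  fixes S :: "'a::metric_space set"
  assumes "\<And>s :: nat \<Rightarrow> 'a. (\<And>n. s n \<in> S) \<Longrightarrow> \<exists>l r. strict_mono (r :: nat \<Rightarrow> nat) \<and> (s \<circ> r) \<longlonglongrightarrow> l"
  shows "compact (closure S)"
  unfolding compact_def
proof (intro allI impI)
  fix y :: "nat \<Rightarrow> 'a" assume y: "\<forall>n. y n \<in> closure S"
  have "\<exists>z. z \<in> S \<and> dist z (y n) < inverse (real (Suc n))" for n
    using y[rule_format, of n, unfolded closure_approachable, rule_format, of "inverse (real (Suc n))"]
    by auto
  then have "\<exists>s. \<forall>n. s n \<in> S \<and> dist (s n) (y n) < inverse (real (Suc n))"
    by (intro choice) blast
  then obtain s where s: "\<And>n. s n \<in> S" "\<And>n. dist (s n) (y n) < inverse (real (Suc n))"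
    by blast
  obtain l r where r: "strict_mono (r :: nat \<Rightarrow> nat)" and l: "(s \<circ> r) \<longlonglongrightarrow> l"
    using assms[of s] s(1) by blast
  have "norm (dist (s n) (y n)) \<le> inverse (real (Suc n))" for n
    using s(2)[of n] by (simp del: of_nat_Suc)
  then have d: "(\<lambda>n. dist (s n) (y n)) \<longlonglongrightarrow> 0"
    by (rule Lim_null_comparison[OF always_eventually[OF allI] LIMSEQ_inverse_real_of_nat])
  have "(\<lambda>n. dist (y (r n)) l) \<longlonglongrightarrow> 0"
  proof (rule Lim_null_comparison)
    show "\<forall>\<^sub>F n in sequentially. norm (dist (y (r n)) l) \<le> dist (s (r n)) (y (r n)) + dist (s (r n)) l"
      by (simp add: dist_triangle3)
    show "(\<lambda>n. dist (s (r n)) (y (r n)) + dist (s (r n)) l) \<longlonglongrightarrow> 0"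
      using tendsto_add[OF LIMSEQ_subseq_LIMSEQ[OF d r] tendsto_dist_iff[THEN iffD1, OF l]] by (simp add: o_def)
  qed
  then have "(y \<circ> r) \<longlonglongrightarrow> l" unfolding o_def by (rule iffD2[OF tendsto_dist_iff])
  moreover from this have "l \<in> closure S"
    using closed_sequentially[OF closed_closure, of "y \<circ> r" S l] y by simp
  ultimately show "\<exists>l\<in>closure S. \<exists>r. strict_mono r \<and> (y \<circ> r) \<longlonglongrightarrow> l" using r by blast
qed

section \<open>Compactness and continuity of $\Psi$\<close>

text \<open>The forcing, including its final \<open>- x\<close>, as a continuous map between
  finite-dimensional spaces. The three pairs are (x, x') at the times t,
  \<open>t - \<tau>\<^sub>0\<close> and \<open>t - \<tau>\<^sub>c\<close>; whole pairs are used so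
  that \<open>delays\<close> can shift the jet as a single function.\<close>

definition nonlinearity :: "real \<Rightarrow> real \<Rightarrow> real \<Rightarrow> real \<Rightarrow> real \<Rightarrow>
    ((real ^ ('n::finite mod_ring)) \<times> (real ^ ('n mod_ring))) \<times>
    ((real ^ ('n mod_ring)) \<times> (real ^ ('n mod_ring))) \<times>
    ((real ^ ('n mod_ring)) \<times> (real ^ ('n mod_ring))) \<Rightarrow> real ^ ('n mod_ring)" where
  "nonlinearity \<eta> \<alpha> c \<beta> b = (\<lambda>(w, w\<^sub>0, w\<^sub>c). \<chi> k.
     - \<eta> * snd w $ k - \<alpha> * fst w $ k - b * fst w\<^sub>0 $ k
     + c * (fst w\<^sub>c $ (k + of_int_mod_ring 1) - 2 * fst w $ k + fst w\<^sub>c $ (k - of_int_mod_ring 1))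
     - \<beta> * (fst w $ k) ^ 3 - fst w $ k)"

definition jet :: "'a::euclidean_space H2 \<Rightarrow> real \<Rightarrow> 'a \<times> 'a" where
  "jet x t = (h2_fun x t, h2_deriv x t)"

definition delays :: "real \<Rightarrow> real \<Rightarrow> (real \<Rightarrow> 'a) \<Rightarrow> real \<Rightarrow> 'a \<times> 'a \<times> 'a" where
  "delays \<tau>\<^sub>0 \<tau>\<^sub>c w t = (w t, w (t - \<tau>\<^sub>0), w (t - \<tau>\<^sub>c))"

lemma jet_periodic: "jet x (t + 2 * pi) = jet x t"
  by (simp add: jet_def h2_fun_periodic h2_deriv_periodic)

lemma jet_cont: "continuous_on UNIV (jet x)"
  unfolding jet_def by (intro continuous_intros h2_fun_cont h2_deriv_cont)

lemma nonlinearity_cont: "continuous_on UNIV (nonlinearity \<eta> \<alpha> c \<beta> b)"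
  unfolding nonlinearity_def case_prod_beta by (intro continuous_intros)

lemma delays_periodic:
  assumes "\<And>t. w (t + 2 * pi) = w t"
  shows "delays \<tau>\<^sub>0 \<tau>\<^sub>c w (t + 2 * pi) = delays \<tau>\<^sub>0 \<tau>\<^sub>c w t"
  using assms[of t] assms[of "t - \<tau>\<^sub>0"] assms[of "t - \<tau>\<^sub>c"]
  by (simp add: delays_def diff_add_eq)

lemma delays_cont:
  assumes "continuous_on UNIV w"
  shows "continuous_on UNIV (delays \<tau>\<^sub>0 \<tau>\<^sub>c w)"
  unfolding delays_def
  by (intro continuous_on_Pair assms continuous_on_compose2[OF assms] continuous_intros) auto

lemma F_op_nonlinearity:
  "F_op \<eta> \<alpha> c \<beta> \<tau>\<^sub>c (b, \<tau>\<^sub>0) x t - h2_fun x t = nonlinearity \<eta> \<alpha> c \<beta> b (delays \<tau>\<^sub>0 \<tau>\<^sub>c (jet x) t)"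
  by (simp add: vec_eq_iff F_op_def nonlinearity_def delays_def jet_def)

lemma nonlinearity_delays_cont:
  "continuous_on UNIV w \<Longrightarrow> continuous_on UNIV (\<lambda>t. nonlinearity \<eta> \<alpha> c \<beta> b (delays \<tau>\<^sub>0 \<tau>\<^sub>c w t))"
  by (rule continuous_on_compose2[OF nonlinearity_cont delays_cont]) auto

lemma forcing_cont: "continuous_on UNIV (\<lambda>t. F_op \<eta> \<alpha> c \<beta> \<tau>\<^sub>c p x t - h2_fun x t)"
  by (cases p) (simp only: F_op_nonlinearity nonlinearity_delays_cont jet_cont)

lemma forcing_periodic:
  "F_op \<eta> \<alpha> c \<beta> \<tau>\<^sub>c p x (t + 2 * pi) - h2_fun x (t + 2 * pi) = F_op \<eta> \<alpha> c \<beta> \<tau>\<^sub>c p x t - h2_fun x t"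
  by (cases p) (simp only: F_op_nonlinearity delays_periodic jet_periodic)

section \<open>The compact part: continuity and relative compactness\<close>

lemma A_inv_tendsto:
  assumes "uniform_limit UNIV y l sequentially"
    and "\<And>n. continuous_on UNIV (y n)" "\<And>n t. y n (t + 2 * pi) = y n t"
  shows "(\<lambda>n. A_inv (y n)) \<longlonglongrightarrow> A_inv l"
proof (rule tendstoI)
  fix e :: real assume e: "0 < e"
  have lc: "continuous_on UNIV l"
    by (rule uniform_limit_theorem[OF _ assms(1)]) (simp_all add: assms(2))
  have lp: "l (t + 2 * pi) = l t" for t by (rule periodic_uniform_limit[OF assms(1,3)])
  \<comment> \<open>With Lipschitz constant 3, the bound e / 4 on the forcing gives 3 e / 4 <
    e.\<close>
  have "\<forall>\<^sub>F n in sequentially. \<forall>t\<in>UNIV. dist (y n t) (l t) < e / 4"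
    by (rule uniform_limitD[OF assms(1)]) (use e in simp)
  then show "\<forall>\<^sub>F n in sequentially. dist (A_inv (y n)) (A_inv l) < e"
  proof eventually_elim
    case (elim n)
    have "norm (A_inv (y n) - A_inv l) \<le> 3 * (e / 4)"
      by (rule A_inv_diff_le[OF assms(2,3) lc lp])
         (use elim e in \<open>auto simp: dist_norm intro: less_imp_le\<close>)
    then show ?case using e by (simp add: dist_norm)
  qed
qed

definition compact_part :: "real \<Rightarrow> real \<Rightarrow> real \<Rightarrow> real \<Rightarrow> real \<Rightarrow> real \<times> real \<Rightarrow>
    (real ^ ('n::finite mod_ring)) H2 \<Rightarrow> (real ^ ('n mod_ring)) H2" where
  "compact_part \<eta> \<alpha> c \<beta> \<tau>\<^sub>c p x = A_inv (\<lambda>t. F_op \<eta> \<alpha> c \<beta> \<tau>\<^sub>c p x t - h2_fun x t)"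

lemma Psi_compact_part: "Psi \<eta> \<alpha> c \<beta> \<tau>\<^sub>c p x = x - compact_part \<eta> \<alpha> c \<beta> \<tau>\<^sub>c p x"
  by (simp add: Psi_def compact_part_def)

text \<open>The limit \<open>w\<close> need not be the jet of an element of the Sobolev space. The
  lemma therefore serves both continuity, where \<open>w\<close> is \<open>jet l\<close>, and
  compactness, where \<open>w\<close> comes from Arzela-Ascoli.\<close>

lemma compact_part_tendsto:
  assumes lim: "uniform_limit UNIV (\<lambda>n. jet (x n)) w sequentially"
  shows "(\<lambda>n. compact_part \<eta> \<alpha> c \<beta> \<tau>\<^sub>c (b, \<tau>\<^sub>0) (x n)) \<longlonglongrightarrow>
    A_inv (\<lambda>t. nonlinearity \<eta> \<alpha> c \<beta> b (delays \<tau>\<^sub>0 \<tau>\<^sub>c w t))"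
proof -
  have wc: "continuous_on UNIV w"
    by (rule uniform_limit_theorem[OF _ lim]) (simp_all add: jet_cont)
  have wp: "w (t + 2 * pi) = w t" for t
    by (rule periodic_uniform_limit[OF lim]) (rule jet_periodic)
  have "uniform_limit UNIV (\<lambda>n. delays \<tau>\<^sub>0 \<tau>\<^sub>c (jet (x n))) (delays \<tau>\<^sub>0 \<tau>\<^sub>c w) sequentially"
    unfolding delays_def
    by (intro uniform_limit_Pair lim uniform_limit_compose'[OF lim]) auto
  moreover have "bounded (range (delays \<tau>\<^sub>0 \<tau>\<^sub>c w))"
    by (rule continuous_periodic_bounded) (rule delays_cont[OF wc], rule delays_periodic, rule wp)
  ultimately have "uniform_limit UNIV (\<lambda>n t. nonlinearity \<eta> \<alpha> c \<beta> b (delays \<tau>\<^sub>0 \<tau>\<^sub>c (jet (x n)) t))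
      (\<lambda>t. nonlinearity \<eta> \<alpha> c \<beta> b (delays \<tau>\<^sub>0 \<tau>\<^sub>c w t)) sequentially"
    by (rule uniform_limit_continuous_compose[OF _ nonlinearity_cont])
  then show ?thesis
    unfolding compact_part_def F_op_nonlinearity
    by (rule A_inv_tendsto)
       (simp_all only: nonlinearity_delays_cont jet_cont delays_periodic jet_periodic)
qed

lemma norm_jet_diff_le: "norm (jet x t - jet z t) \<le> 8 * norm (x - z)"
proof -
  have "norm (jet x t - jet z t) \<le> norm (h2_fun (x - z) t) + norm (h2_deriv (x - z) t)"
    by (simp add: jet_def h2_fun_diff h2_deriv_diff norm_Pair sqrt_sum_squares_le_sum)
  then show ?thesis
    using norm_h2_fun_le[of "x - z" t] norm_h2_deriv_le[of "x - z" t] by linarith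
qed

lemma compact_part_cont:
  "continuous_on UNIV (compact_part \<eta> \<alpha> c \<beta> \<tau>\<^sub>c p)"
proof (rule continuous_on_sequentiallyI)
  fix x :: "nat \<Rightarrow> (real ^ ('n::finite mod_ring)) H2" and l assume x: "x \<longlonglongrightarrow> l"
  obtain b \<tau>\<^sub>0 where p: "p = (b, \<tau>\<^sub>0)" by (cases p)
  have "uniform_limit UNIV (\<lambda>n. jet (x n)) (jet l) sequentially"
  proof (rule uniform_limitI)
    fix e :: real assume "0 < e"
    then have "\<forall>\<^sub>F n in sequentially. dist (x n) l < e / 8" using tendstoD[OF x, of "e / 8"] by simp
    then show "\<forall>\<^sub>F n in sequentially. \<forall>t\<in>UNIV. dist (jet (x n) t) (jet l t) < e"
    proof eventually_elim
      case (elim n)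
      have "dist (jet (x n) t) (jet l t) < e" for t
        using norm_jet_diff_le[of "x n" t l] elim unfolding dist_norm by linarith
      then show ?case by blast
    qed
  qed
  from compact_part_tendsto[OF this]
  show "(\<lambda>n. compact_part \<eta> \<alpha> c \<beta> \<tau>\<^sub>c p (x n)) \<longlonglongrightarrow> compact_part \<eta> \<alpha> c \<beta> \<tau>\<^sub>c p l"
    unfolding p compact_part_def[of _ _ _ _ _ _ l] F_op_nonlinearity .
qed

text \<open>On a bounded set the jets (x, x') are uniformly bounded, and Hoelder continuous of
  exponent 1/2 on a period with a common constant, because x' and x'' are bounded in L^2. A
  subsequence of the jets converges uniformly, and this suffices for the images to converge.\<close>

lemma compact_part_relatively_compact:
  assumes "bounded B"
  shows "compact (closure (compact_part \<eta> \<alpha> c \<beta> \<tau>\<^sub>c p ` B))"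
proof (rule compact_closure_sequentialI)
  fix s assume "\<And>n :: nat. s n \<in> compact_part \<eta> \<alpha> c \<beta> \<tau>\<^sub>c p ` B"
  then obtain x where x: "\<And>n. x n \<in> B" "\<And>n. s n = compact_part \<eta> \<alpha> c \<beta> \<tau>\<^sub>c p (x n)"
    unfolding image_iff by metis
  obtain R where R: "0 < R" "\<And>z. z \<in> B \<Longrightarrow> norm z \<le> R"
    using assms by (auto simp: bounded_pos)
  have sq: "(norm (x n))\<^sup>2 \<le> R\<^sup>2" for n using R(2)[OF x(1)[of n]] by (intro power_mono) auto
  obtain b \<tau>\<^sub>0 where p: "p = (b, \<tau>\<^sub>0)" by (cases p)
  obtain w r where r: "strict_mono (r :: nat \<Rightarrow> nat)"
    and w: "uniform_limit UNIV (\<lambda>n. jet (x (r n))) w sequentially"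
  proof (rule periodic_Arzela_Ascoli[of "\<lambda>n. jet (x n)" "8 * R" "2 * R"])
    \<comment> \<open>Comparison with the jet of 0, which is zero.\<close>
    show "norm (jet (x n) t) \<le> 8 * R" for n t
      using norm_jet_diff_le[of "x n" t 0] R(2)[OF x(1)[of n]]
      by (simp add: jet_def zero_H2.rep_eq h2_deriv_scaleR[of 0 0, simplified] flip: zero_prod_def)
    show "norm (jet (x n) t - jet (x n) s) \<le> 2 * R * sqrt (t - s)"
      if "0 \<le> s" "s \<le> t" "t \<le> 2 * pi" for n s t
    proof -
      have "norm (jet (x n) t - jet (x n) s)
          \<le> norm (h2_fun (x n) t - h2_fun (x n) s) + norm (h2_deriv (x n) t - h2_deriv (x n) s)"
        by (simp add: jet_def norm_Pair sqrt_sum_squares_le_sum)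
      also have "\<dots> \<le> R * sqrt (t - s) + R * sqrt (t - s)"
        using that R(1)
        by (intro add_mono has_ac_derivative_L2_Hoelder[OF h2_fun_ac h2_deriv_L2 order_trans[OF h2_L2_norms_le(2) sq]]
          has_ac_derivative_L2_Hoelder[OF h2_deriv2(2,1) order_trans[OF h2_L2_norms_le(3) sq]]) auto
      finally show ?thesis by simp
    qed
  qed (use R(1) jet_periodic in auto)
  have "(s \<circ> r) \<longlonglongrightarrow> A_inv (\<lambda>t. nonlinearity \<eta> \<alpha> c \<beta> b (delays \<tau>\<^sub>0 \<tau>\<^sub>c w t))"
    using compact_part_tendsto[OF w] unfolding o_def x(2) p .
  then show "\<exists>l r. strict_mono (r :: nat \<Rightarrow> nat) \<and> (s \<circ> r) \<longlonglongrightarrow> l" using r by blast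
qed

lemma Psi_compact_perturbation: "compact_perturbation_of_id (Psi \<eta> \<alpha> c \<beta> \<tau>\<^sub>c p)"
  unfolding compact_perturbation_of_id_def
proof (intro conjI allI impI)
  have e: "Psi \<eta> \<alpha> c \<beta> \<tau>\<^sub>c p x - x = - compact_part \<eta> \<alpha> c \<beta> \<tau>\<^sub>c p x" for x
    by (simp add: Psi_compact_part)
  show "continuous_on UNIV (\<lambda>x. Psi \<eta> \<alpha> c \<beta> \<tau>\<^sub>c p x - x)"
    unfolding e by (intro continuous_on_minus compact_part_cont)
  fix B :: "(real ^ ('n::finite mod_ring)) H2 set" assume "bounded B"
  \<comment> \<open>Negation is written as scaling by -1, so that \<open>closure_scaleR\<close>
    moves it through the closure.\<close>
  then have "compact ((*\<^sub>R) (- 1) ` closure (compact_part \<eta> \<alpha> c \<beta> \<tau>\<^sub>c p ` B))"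
    by (intro compact_continuous_image compact_part_relatively_compact continuous_intros)
  then show "compact (closure ((\<lambda>x. Psi \<eta> \<alpha> c \<beta> \<tau>\<^sub>c p x - x) ` B))"
    unfolding e closure_scaleR by (simp add: image_image)
qed

section \<open>Dependence on the parameters\<close>

text \<open>Only the delayed term b x(t - \<tau>) depends on the parameters. The Lipschitz constant
  and the supremum of x are both at most 4 R, and \<open>A_inv\<close> contributes the factor
  3.\<close>

lemma Psi_param_diff_le:
  assumes "norm x \<le> R"
  shows "norm (Psi \<eta> \<alpha> c \<beta> \<tau>\<^sub>c (b', \<tau>') x - Psi \<eta> \<alpha> c \<beta> \<tau>\<^sub>c (b, \<tau>) x)
    \<le> 12 * R * (\<bar>b\<bar> * \<bar>\<tau>' - \<tau>\<bar> + \<bar>b' - b\<bar>)"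
proof -
  have R: "0 \<le> R" using assms norm_ge_zero order_trans by blast
  have "norm (compact_part \<eta> \<alpha> c \<beta> \<tau>\<^sub>c (b, \<tau>) x - compact_part \<eta> \<alpha> c \<beta> \<tau>\<^sub>c (b', \<tau>') x)
      \<le> 3 * (4 * R * (\<bar>b\<bar> * \<bar>\<tau>' - \<tau>\<bar> + \<bar>b' - b\<bar>))"
    unfolding compact_part_def
  proof (rule A_inv_diff_le[OF forcing_cont forcing_periodic forcing_cont forcing_periodic])
    fix t
    define u where "u = h2_fun x"
    \<comment> \<open>Adding and subtracting b u(t - \<tau>') separates the change of the delay from
      the change of the coefficient.\<close>
    have "F_op \<eta> \<alpha> c \<beta> \<tau>\<^sub>c (b, \<tau>) x t - h2_fun x t - (F_op \<eta> \<alpha> c \<beta> \<tau>\<^sub>c (b', \<tau>') x t - h2_fun x t)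
        = b *\<^sub>R (u (t - \<tau>') - u (t - \<tau>)) + (b' - b) *\<^sub>R u (t - \<tau>')"
      by (simp add: vec_eq_iff F_op_def u_def algebra_simps)
    also have "norm \<dots> \<le> \<bar>b\<bar> * norm (u (t - \<tau>') - u (t - \<tau>)) + \<bar>b' - b\<bar> * norm (u (t - \<tau>'))"
      by (rule norm_triangle_le) simp
    also have "\<dots> \<le> \<bar>b\<bar> * (4 * R * \<bar>\<tau>' - \<tau>\<bar>) + \<bar>b' - b\<bar> * (4 * R)"
    proof (intro add_mono mult_left_mono)
      have "norm (u (t - \<tau>') - u (t - \<tau>)) \<le> 4 * norm x * \<bar>(t - \<tau>') - (t - \<tau>)\<bar>"
        unfolding u_def by (rule h2_fun_Lipschitz)
      also have "\<dots> \<le> 4 * R * \<bar>\<tau>' - \<tau>\<bar>" using assms R by (intro mult_mono) auto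
      finally show "norm (u (t - \<tau>') - u (t - \<tau>)) \<le> 4 * R * \<bar>\<tau>' - \<tau>\<bar>" .
      show "norm (u (t - \<tau>')) \<le> 4 * R"
        using norm_h2_fun_le[of x "t - \<tau>'"] assms unfolding u_def by linarith
    qed auto
    finally show "norm (F_op \<eta> \<alpha> c \<beta> \<tau>\<^sub>c (b, \<tau>) x t - h2_fun x t
        - (F_op \<eta> \<alpha> c \<beta> \<tau>\<^sub>c (b', \<tau>') x t - h2_fun x t)) \<le> 4 * R * (\<bar>b\<bar> * \<bar>\<tau>' - \<tau>\<bar> + \<bar>b' - b\<bar>)"
      by (simp add: algebra_simps)
  qed (use R in simp)
  then show ?thesis by (simp add: Psi_compact_part)
qed

lemma Psi_param_tendsto:
  assumes "bounded B"
  shows "((\<lambda>p'. SUP x\<in>B. ennreal (norm (Psi \<eta> \<alpha> c \<beta> \<tau>\<^sub>c p' x - Psi \<eta> \<alpha> c \<beta> \<tau>\<^sub>c p x))) \<longlongrightarrow> 0) (at p within S)"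
proof -
  obtain R where R: "\<And>x. x \<in> B \<Longrightarrow> norm x \<le> R" using assms by (auto simp: bounded_iff)
  define h where "h = (\<lambda>p'. 12 * R * (\<bar>fst p\<bar> * \<bar>snd p' - snd p\<bar> + \<bar>fst p' - fst p\<bar>))"
  have "(h \<longlongrightarrow> 12 * R * (\<bar>fst p\<bar> * \<bar>snd p - snd p\<bar> + \<bar>fst p - fst p\<bar>)) (at p within S)"
    unfolding h_def by (intro tendsto_intros)
  then have h0: "((\<lambda>p'. ennreal (h p')) \<longlongrightarrow> 0) (at p within S)"
    using tendsto_ennrealI by fastforce
  show ?thesis
  \<comment> \<open>The bound \<open>h\<close> does not involve x, so it also bounds the supremum
    over B, and it tends to 0 at p.\<close>
  proof (rule tendsto_sandwich[OF _ _ tendsto_const h0])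
    show "\<forall>\<^sub>F p' in at p within S.
        (SUP x\<in>B. ennreal (norm (Psi \<eta> \<alpha> c \<beta> \<tau>\<^sub>c p' x - Psi \<eta> \<alpha> c \<beta> \<tau>\<^sub>c p x))) \<le> ennreal (h p')"
    proof (intro always_eventually allI SUP_least ennreal_leI)
      fix p' x assume "x \<in> B"
      then show "norm (Psi \<eta> \<alpha> c \<beta> \<tau>\<^sub>c p' x - Psi \<eta> \<alpha> c \<beta> \<tau>\<^sub>c p x) \<le> h p'"
        using Psi_param_diff_le[OF R, of x \<eta> \<alpha> c \<beta> \<tau>\<^sub>c "fst p'" "snd p'" "fst p" "snd p"]
        by (simp add: h_def)
    qed
  qed simp
qed

section \<open>Equivariance\<close>

lemma h2_deriv_act:
  "h2_deriv (act_H2 (\<gamma>, \<iota>, \<theta>) x) t = \<iota> *\<^sub>R permute_coords \<gamma> (h2_deriv x (t + \<theta>))"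
proof -
  have "h2_deriv (act_H2 (\<gamma>, \<iota>, \<theta>) x) = (\<lambda>t. \<iota> *\<^sub>R permute_coords \<gamma> (h2_deriv x (t + \<theta>)))"
    by (rule h2_deriv_eqI)
       (auto simp: act_H2.rep_eq intro!: bounded_linear.has_vector_derivative[OF bounded_linear_permute]
         has_vector_derivative_shift h2_deriv)
  then show ?thesis by simp
qed

text \<open>Shifts and constant linear maps commute with differentiation, so the transformed
  solution solves the equation classically with the transformed forcing; uniqueness identifies
  it.\<close>

lemma act_H2_A_inv:
  assumes y: "continuous_on UNIV y" "\<And>t. y (t + 2 * pi) = y t"
  shows "act_H2 (\<gamma>, \<iota>, \<theta>) (A_inv y) = A_inv (\<lambda>t. \<iota> *\<^sub>R permute_coords \<gamma> (y (t + \<theta>)))"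
proof (rule A_inv_eqI[symmetric])
  interpret bounded_linear "\<lambda>v. \<iota> *\<^sub>R permute_coords \<gamma> v" by (rule bounded_linear_permute)
  show "(h2_deriv (act_H2 (\<gamma>, \<iota>, \<theta>) (A_inv y)) has_vector_derivative
      \<iota> *\<^sub>R permute_coords \<gamma> (y (t + \<theta>)) + h2_fun (act_H2 (\<gamma>, \<iota>, \<theta>) (A_inv y)) t) (at t)" for t
    using has_vector_derivative[OF has_vector_derivative_shift[OF A_inv_solves[OF y, of "t + \<theta>"]]]
    by (simp add: h2_deriv_act[abs_def] act_H2.rep_eq add)
  show "continuous_on UNIV (\<lambda>t. \<iota> *\<^sub>R permute_coords \<gamma> (y (t + \<theta>)))"
    by (intro continuous_on continuous_on_compose2[OF y(1)] continuous_intros) auto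
qed

lemma act_H2_diff: "act_H2 g (x - z) = act_H2 g x - act_H2 g z"
proof -
  obtain \<gamma> \<iota> \<theta> where g: "g = (\<gamma>, \<iota>, \<theta>)" by (cases g) auto
  interpret bounded_linear "\<lambda>v. \<iota> *\<^sub>R permute_coords \<gamma> v" by (rule bounded_linear_permute)
  show ?thesis
    unfolding g h2_fun_inject[symmetric]
    by (rule ext) (simp add: act_H2.rep_eq h2_fun_diff diff)
qed

lemma inv_rotation: "inv_into UNIV (\<lambda>k. k + m) j = (j - m :: 'n::finite mod_ring)"
  by (rule inv_f_eq) (auto intro: injI)

lemma inv_reflection: "inv_into UNIV (\<lambda>k. m - k) j = (m - j :: 'n::finite mod_ring)"
  by (rule inv_f_eq) (auto intro: injI)

text \<open>The equation is autonomous, which gives the shifts. The cubic term is compatible with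
  the sign because \<iota> cubed is \<iota>. Rotations preserve the neighbours k + 1 and k - 1,
  while reflections exchange them, and the coupling is symmetric in the two.\<close>

lemma F_op_act:
  assumes "\<gamma> \<in> dihedral" "\<iota> \<in> {1, - 1}"
  shows "F_op \<eta> \<alpha> c \<beta> \<tau>\<^sub>c p (act_H2 (\<gamma>, \<iota>, \<theta>) x) t
    = \<iota> *\<^sub>R permute_coords \<gamma> (F_op \<eta> \<alpha> c \<beta> \<tau>\<^sub>c p x (t + \<theta>))"
proof -
  obtain b \<tau>\<^sub>0 where p: "p = (b, \<tau>\<^sub>0)" by (cases p)
  have cube: "(\<iota> * r) ^ 3 = \<iota> * r ^ 3" for r :: real using assms(2) by auto
  have s: "t - \<tau> + \<theta> = t + \<theta> - \<tau>" for \<tau> by simp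
  obtain m where "\<gamma> = (\<lambda>k. k + m) \<or> \<gamma> = (\<lambda>k. m - k)"
    using assms(1) by (auto simp: dihedral_def)
  then show ?thesis
  proof
    assume \<gamma>: "\<gamma> = (\<lambda>k. k + m)"
    have n: "k + j - m = k - m + j" "k - j - m = k - m - j" for j k by simp_all
    show ?thesis
      by (simp add: vec_eq_iff F_op_def p act_H2.rep_eq h2_deriv_act permute_coords_def \<gamma>
          inv_rotation n cube s) (simp add: algebra_simps)
  next
    assume \<gamma>: "\<gamma> = (\<lambda>k. m - k)"
    \<comment> \<open>Here the two neighbours change places; the closing
      \<open>algebra_simps\<close> reorders their sum.\<close>
    have n: "m - (k + j) = m - k - j" "m - (k - j) = m - k + j" for j k by simp_all
    show ?thesis
      by (simp add: vec_eq_iff F_op_def p act_H2.rep_eq h2_deriv_act permute_coords_def \<gamma>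
          inv_reflection n cube s) (simp add: algebra_simps)
  qed
qed

lemma Psi_equivariant:
  assumes "g \<in> G_sym"
  shows "Psi \<eta> \<alpha> c \<beta> \<tau>\<^sub>c p (act_H2 g x) = act_H2 g (Psi \<eta> \<alpha> c \<beta> \<tau>\<^sub>c p x)"
proof -
  obtain \<gamma> \<iota> \<theta> where g: "g = (\<gamma>, \<iota>, \<theta>)" and \<gamma>: "\<gamma> \<in> dihedral" and \<iota>: "\<iota> \<in> {1, - 1}"
    using assms by (auto simp: G_sym_def)
  interpret bounded_linear "\<lambda>v. \<iota> *\<^sub>R permute_coords \<gamma> v" by (rule bounded_linear_permute)
  have "compact_part \<eta> \<alpha> c \<beta> \<tau>\<^sub>c p (act_H2 g x) = act_H2 g (compact_part \<eta> \<alpha> c \<beta> \<tau>\<^sub>c p x)"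
    unfolding compact_part_def g act_H2_A_inv[OF forcing_cont forcing_periodic]
    by (simp only: F_op_act[OF \<gamma> \<iota>] act_H2.rep_eq case_prod_conv diff)
  then show ?thesis by (simp add: Psi_compact_part act_H2_diff)
qed

theorem theorem2p1:
  fixes a \<delta> c \<beta> \<tau>\<^sub>c :: real
    and \<Psi> :: "real \<times> real \<Rightarrow> (real ^ ('n::finite mod_ring)) H2 \<Rightarrow> (real ^ ('n mod_ring)) H2"
  assumes "a > 0" and "\<delta> > 0" and "c \<ge> 0" and "\<beta> > 0" and "\<tau>\<^sub>c \<ge> 0"
    and \<Psi>: "\<Psi> = Psi (a + \<delta>) (a * \<delta>) c \<beta> \<tau>\<^sub>c"
  shows "(\<forall>p\<in>param_domain. \<forall>g\<in>G_sym. \<forall>x. \<Psi> p (act_H2 g x) = act_H2 g (\<Psi> p x))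
    \<and> (\<forall>p\<in>param_domain. compact_perturbation_of_id (\<Psi> p))
    \<and> (\<forall>p\<in>param_domain. \<forall>B. bounded B \<longrightarrow>
         ((\<lambda>p'. SUP x\<in>B. ennreal (norm (\<Psi> p' x - \<Psi> p x))) \<longlongrightarrow> 0) (at p within param_domain))"
  unfolding \<Psi>
  by (intro conjI ballI allI impI Psi_equivariant Psi_compact_perturbation Psi_param_tendsto)

end
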